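(* Let $\chi(x)=(2\pi)^{-d/2}\prod_{i=1}^d e^{-x_i^2/2}$, $x=(x_1,\ldots,x_d)\in\mathbb{R}^d$, be the multivariate normal kernel. Let $\Pi^*$ be a Type I or Type II location-scale mixture prior with kernel $\frac{1}{\phi^d}\chi\big(\frac{x-\theta}{\phi}\big)$, as defined in the context, and assume that the prior $\Pi$ for the mixing distribution satisfies the weak support condition (B8) stated there. Let $f_0$ be a continuous density on $\mathbb{R}^d$ such that (B4) for some $0<M<\infty$, $0<f_0(x)\le M$ for all $x$; (B5) $\left|\int f_0(x)\log f_0(x)\,dx\right|<\infty$; (B6) for some $\delta>0$, $\int f_0(x)\log\frac{f_0(x)}{\phi_\delta(x)}\,dx<\infty$, where $\phi_\delta(x)=\inf_{\|t-x\|<\delta}f_0(t)$; and $\int\|x\|^{2(1+\eta)}f_0(x)\,dx<\infty$ for some $\eta>0$. Then $f_0\in\mathrm{KL}(\Pi^* )$.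
   Context: $\|\cdot\|$ is the Euclidean norm, $\mathscr{M}(S)$ is the set of probability measures on $S$, $\mathbb{R}^+=(0,\infty)$; a prior is a probability measure on the indicated space; the weak support of a prior on $\mathscr{M}(S)$ is its support in the topology of weak convergence. For a density $\chi$ on $\mathbb{R}^d$: a Type I location-scale mixture prior $\Pi^*$ is the law of $f_P(x)=\int\frac1{\phi^d}\chi\big(\frac{x-\theta}{\phi}\big)dP(\theta,\phi)$ with $P\sim\Pi$, $\Pi$ a prior on $\mathscr{M}(\mathbb{R}^d\times\mathbb{R}^+)$; condition (B8): the weak support of $\Pi$ is $\mathscr{M}(\mathbb{R}^d\times\mathbb{R}^+)$. A Type II location-scale mixture prior $\Pi^*$ is the law of $f_{P,\phi}(x)=\int\frac1{\phi^d}\chi\big(\frac{x-\theta}{\phi}\big)dP(\theta)$ with independent $P\sim\Pi$ and $\phi\sim\mu$, $\Pi$ a prior on $\mathscr{M}(\mathbb{R}^d)$ and $\mu$ a prior on $(0,\infty)$; condition (B8) then reads: the weak support of $\Pi$ is $\mathscr{M}(\mathbb{R}^d)$. $f_0\in\mathrm{KL}(\Pi^* )$ means $\Pi^*(\{f:\int f_0\log(f_0/f)<\epsilon\})>0$ for every $\epsilon>0$.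
   Formalization: For Type II priors the formal theorem also assumes that μ gives positive mass to (0,r) for every r>0; without it the claim fails, e.g. d=1, μ the point mass at 1, f0 the N(0,1/100) density. *)

theory Defs
  imports "HOL-Probability.Probability"
begin

definition prob_measures :: "'a::topological_space set \<Rightarrow> 'a measure set" where
  "prob_measures S = space (prob_algebra (restrict_space borel S))"

text \<open>
  The coarsest topology on the probability measures on \<open>S\<close> for which integration against
  every bounded continuous function on \<open>S\<close> is continuous.  Continuity is relative to \<open>S\<close>, so
  for \<open>S\<close> a half-space, the test functions need not extend to its boundary.
\<close>

definition weak_topology :: "'a::topological_space set \<Rightarrow> 'a measure topology" where
  "weak_topology S = topology_generated_by
     {{P \<in> prob_measures S. (\<integral>s. g s \<partial>P) \<in> V} | (g :: 'a \<Rightarrow> real) V.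
        continuous_on S g \<and> bounded (g ` S) \<and> open V}"

lemma topspace_weak_topology: "topspace (weak_topology S) = prob_measures S"
proof
  show "topspace (weak_topology S) \<subseteq> prob_measures S"
    by (auto simp: weak_topology_def topology_generated_by_topspace)
  have "prob_measures S = {P \<in> prob_measures S. (\<integral>s. (0::real) \<partial>P) \<in> UNIV}"
    by simp
  then have "prob_measures S \<in> {{P \<in> prob_measures S. (\<integral>s. g s \<partial>P) \<in> V} | (g :: 'a \<Rightarrow> real) V.
        continuous_on S g \<and> bounded (g ` S) \<and> open V}"
    by (intro CollectI exI[of _ "\<lambda>_. 0"] exI[of _ UNIV]) (auto simp: bounded_iff)
  then show "prob_measures S \<subseteq> topspace (weak_topology S)"
    unfolding weak_topology_def topology_generated_by_topspace by blast
qed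

text \<open>
  Priors on the space of probability measures on \<open>S\<close>.  The sigma-algebra is the one generated
  by the evaluations \<open>P \<mapsto> P A\<close>; for a Polish space \<open>S\<close> it is the Borel sigma-algebra of the
  weak topology.
\<close>

definition mixing_priors :: "'a::topological_space set \<Rightarrow> 'a measure measure set" where
  "mixing_priors S = space (prob_algebra (prob_algebra (restrict_space borel S)))"

definition weak_support :: "'a::topological_space set \<Rightarrow> 'a measure measure \<Rightarrow> 'a measure set" where
  "weak_support S \<Lambda> =
     {P \<in> prob_measures S. \<forall>U. openin (weak_topology S) U \<and> P \<in> U \<longrightarrow> emeasure \<Lambda> U > 0}"

definition normal_kernel :: "real ^ 'n \<Rightarrow> real" where
  "normal_kernel x = (2 * pi) powr (- real CARD('n) / 2) * (\<Prod>i\<in>UNIV. exp (- (x $ i)\<^sup>2 / 2))"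

definition loc_scale :: "(real ^ 'n \<Rightarrow> real) \<Rightarrow> real ^ 'n \<Rightarrow> real \<Rightarrow> real ^ 'n \<Rightarrow> real" where
  "loc_scale K \<theta> \<phi> x = 1 / \<phi> ^ CARD('n) * K ((1 / \<phi>) *\<^sub>R (x - \<theta>))"

text \<open>
  The first mixture may diverge on a Lebesgue null set of points \<open>x\<close> (when the mixing measure puts
  much mass near scale 0); there the integral takes the conventional value 0.  Below, mixtures
  only enter through Lebesgue integrals, so this is harmless.
\<close>

definition mixture_I :: "(real ^ 'n \<Rightarrow> real) \<Rightarrow> ((real ^ 'n) \<times> real) measure \<Rightarrow> real ^ 'n \<Rightarrow> real" where
  "mixture_I K P x = (\<integral>(\<theta>, \<phi>). loc_scale K \<theta> \<phi> x \<partial>P)"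

definition mixture_II :: "(real ^ 'n \<Rightarrow> real) \<Rightarrow> (real ^ 'n) measure \<Rightarrow> real \<Rightarrow> real ^ 'n \<Rightarrow> real" where
  "mixture_II K P \<phi> x = (\<integral>\<theta>. loc_scale K \<theta> \<phi> x \<partial>P)"

text \<open>
  The law of \<open>X\<close> under \<open>M\<close>, on the finest sigma-algebra that makes \<open>X\<close> measurable.  On any
  smaller sigma-algebra that makes \<open>X\<close> measurable, the law of \<open>X\<close> is the restriction of this one.
\<close>

definition law :: "'p measure \<Rightarrow> ('p \<Rightarrow> 'b) \<Rightarrow> 'b measure" where
  "law M X = distr M (sigma UNIV {A. X -` A \<inter> space M \<in> sets M}) X"

lemma sets_law: "sets (law M X) = {A. X -` A \<inter> space M \<in> sets M}"
proof -
  have "sigma_algebra UNIV {A. X -` A \<inter> space M \<in> sets M}"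
  proof (rule sigma_algebra_iff2[THEN iffD2], safe)
    fix A assume "X -` A \<inter> space M \<in> sets M"
    moreover have "X -` (UNIV - A) \<inter> space M = space M - (X -` A \<inter> space M)" by auto
    ultimately show "X -` (UNIV - A) \<inter> space M \<in> sets M" by auto
  next
    fix A :: "nat \<Rightarrow> _" assume "range A \<subseteq> {A. X -` A \<inter> space M \<in> sets M}"
    then have "(\<Union>i. X -` A i \<inter> space M) \<in> sets M" by (intro sets.countable_UN) blast
    moreover have "X -` (\<Union>i. A i) \<inter> space M = (\<Union>i. X -` A i \<inter> space M)" by blast
    ultimately show "X -` (\<Union>i. A i) \<inter> space M \<in> sets M" by (simp only:)
  qed auto
  then show ?thesis
    by (simp add: law_def sigma_algebra.sigma_sets_eq)
qed

lemma emeasure_law: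
  assumes "A \<in> sets (law M X)"
  shows "emeasure (law M X) A = emeasure M (X -` A \<inter> space M)"
proof -
  have "X \<in> measurable M (sigma UNIV {A. X -` A \<inter> space M \<in> sets M})"
    by (rule measurable_measure_of) auto
  then show ?thesis
    using assms by (simp add: law_def emeasure_distr)
qed

definition type_I_prior ::
    "(real ^ 'n \<Rightarrow> real) \<Rightarrow> ((real ^ 'n) \<times> real) measure measure \<Rightarrow> (real ^ 'n \<Rightarrow> real) measure" where
  "type_I_prior K \<Lambda> = law \<Lambda> (mixture_I K)"

definition type_II_prior ::
    "(real ^ 'n \<Rightarrow> real) \<Rightarrow> (real ^ 'n) measure measure \<Rightarrow> real measure \<Rightarrow> (real ^ 'n \<Rightarrow> real) measure" where
  "type_II_prior K \<Lambda> \<mu> = law (\<Lambda> \<Otimes>\<^sub>M \<mu>) (\<lambda>(P, \<phi>). mixture_II K P \<phi>)"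

definition density_fun :: "('a::euclidean_space \<Rightarrow> real) \<Rightarrow> bool" where
  "density_fun f \<longleftrightarrow>
     f \<in> borel_measurable borel \<and> (\<forall>x. 0 \<le> f x) \<and> (\<integral>\<^sup>+x. ennreal (f x) \<partial>lborel) = 1"

text \<open>
  For densities the negative part of the integrand is integrable, so the integral is infinite
  exactly when the integrand is not integrable.  The condition on the zeros of \<open>f\<close> compensates
  for the conventions \<open>a / 0 = 0\<close> and \<open>ln 0 = 0\<close>.
\<close>

definition KL :: "('a::euclidean_space \<Rightarrow> real) \<Rightarrow> ('a \<Rightarrow> real) \<Rightarrow> ereal" where
  "KL f0 f =
     (if (AE x in lborel. 0 < f0 x \<longrightarrow> 0 < f x) \<and> integrable lborel (\<lambda>x. f0 x * ln (f0 x / f x))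
      then ereal (\<integral>x. f0 x * ln (f0 x / f x) \<partial>lborel) else \<infinity>)"

definition KL_support :: "('a::euclidean_space \<Rightarrow> real) measure \<Rightarrow> ('a \<Rightarrow> real) set" where
  "KL_support Pstar = {f0. \<forall>\<epsilon>>0. emeasure Pstar {f. KL f0 f < ereal \<epsilon>} > 0}"

end

theory Submission
  imports Defs
begin

text \<open>
  The divergence \<open>KL f0 f\<close> can be large only where \<open>f\<close> falls below \<open>f0\<close>, so lower bounds for mixtures
  are all that is needed: if \<open>f0 * ln (f0 / f) \<le> H\<close> with \<open>H\<close> integrable, the inequality
  \<open>f0 * ln (f0 / f) \<ge> f0 - f\<close> takes care of integrability from below (\<open>KL_less_if_bounded\<close>).

  Fix a small scale \<open>\<phi>\<close> and let \<open>P0\<close> be the mixing measure under which the location has density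
  \<open>f0\<close> and the scale is \<open>\<phi>\<close>.  The logarithm of the normal kernel is a polynomial of degree two in
  \<open>x\<close> whose coefficients are continuous in the location and the scale.  Hence a small change of the
  parameters changes the kernel by a factor between \<open>exp (- \<rho> * (1 + norm x ^ 2))\<close> and its
  inverse, at all \<open>x\<close> simultaneously.  Dividing a compact set \<open>C\<close> of parameters into finitely many
  small pieces by continuous weights, one finds a weak neighbourhood of \<open>P0\<close> all of whose members
  \<open>P\<close> satisfy \<open>f_P(x) \<ge> exp (- \<rho> * (1 + norm x ^ 2)) * G(x)\<close>, where \<open>G\<close> is the part of the mixture
  over \<open>P0\<close> that comes from \<open>C\<close> (\<open>weak_neighbourhood_kernel_bound\<close>).  The second moment of \<open>f0\<close>
  makes the cost of the factor as small as desired.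

  It remains to bound \<open>G\<close>.  For \<open>norm x \<le> m\<close> the kernel puts nearly all its mass on locations within
  \<open>r\<close> of \<open>x\<close>, so \<open>G(x)\<close> is nearly the infimum of \<open>f0\<close> over the ball of radius \<open>r\<close> about \<open>x\<close>; by
  dominated convergence replacing \<open>f0\<close> by this infimum costs little for small \<open>r\<close>
  (\<open>ball_inf_divergence_small\<close>).  For \<open>norm x > m\<close> it suffices that \<open>G(x) \<ge> exp (- A * (1 + norm x ^ 2))\<close>
  with \<open>A\<close> independent of \<open>m\<close>, because the entropy and the second moment of \<open>f0\<close> are finite, so that
  the tail contributes little for large \<open>m\<close> (\<open>KL_small_on_weak_neighbourhood\<close>).

  For a Type I prior, full weak support gives the neighbourhood positive mass.  For a Type II prior
  the same argument applies at each fixed small scale, and Fubini's theorem combines the scales.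
\<close>

section \<open>Log-quadratic kernels and the weak topology\<close>

definition quad :: "'x::real_normed_vector \<Rightarrow> real" where
  "quad x = 1 + (norm x)\<^sup>2"

lemma quad_ge_1: "1 \<le> quad x"
  by (simp add: quad_def)

lemma borel_measurable_quad [measurable]: "quad \<in> borel_measurable (borel :: 'x::real_normed_vector measure)"
  unfolding quad_def[abs_def] by (intro borel_measurable_continuous_onI continuous_intros)

text \<open>
  This turns closeness of the three coefficients of a quadratic exponent into closeness of the
  exponentials up to a factor whose logarithm is a small multiple of \<open>1 + norm x ^ 2\<close>, and so has a
  small integral against any density with finite second moment.
\<close>

lemma abs_log_quadratic_le:
  fixes c x :: "'x::real_inner"
  shows "\<bar>a + b * (norm x)\<^sup>2 + c \<bullet> x\<bar> \<le> (\<bar>a\<bar> + \<bar>b\<bar> + norm c) * quad x"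
proof -
  have "norm x \<le> quad x"
    using sum_squares_bound[of "norm x" 1] norm_ge_zero[of x]
    unfolding quad_def by (simp only: power2_eq_square)
  then have "\<bar>c \<bullet> x\<bar> \<le> norm c * quad x"
    using Cauchy_Schwarz_ineq2[of c x] mult_left_mono[of "norm x" "quad x" "norm c"] by simp
  moreover have "\<bar>a\<bar> \<le> \<bar>a\<bar> * quad x"
    using mult_left_mono[OF quad_ge_1, of "\<bar>a\<bar>" x] by simp
  moreover have "\<bar>b * (norm x)\<^sup>2\<bar> \<le> \<bar>b\<bar> * quad x"
    by (simp add: abs_mult quad_def mult_left_mono)
  ultimately show ?thesis
    unfolding distrib_right by linarith
qed

text \<open>
  A partition of unity subordinate to balls covering \<open>C\<close>, up to the factor \<open>\<kappa>\<close> on \<open>C\<close>.  Admitting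
  \<open>\<kappa>\<close> lets the weights be continuous on the whole space: tent functions are divided by their sum
  plus a positive constant, which keeps the denominator away from zero outside the cover.
\<close>

lemma weights_on_compact:
  fixes C :: "'a::metric_space set"
  assumes "compact C" and r: "\<And>s. s \<in> C \<Longrightarrow> 0 < r s" and "1 < \<kappa>"
  obtains J :: "'a set" and w :: "'a \<Rightarrow> 'a \<Rightarrow> real" where
    "finite J" "J \<subseteq> C"
    "\<And>s. s \<in> J \<Longrightarrow> continuous_on UNIV (w s)"
    "\<And>s t. s \<in> J \<Longrightarrow> 0 \<le> w s t"
    "\<And>t. (\<Sum>s\<in>J. w s t) \<le> 1"
    "\<And>t. t \<in> C \<Longrightarrow> 1 \<le> \<kappa> * (\<Sum>s\<in>J. w s t)"
    "\<And>s t. s \<in> J \<Longrightarrow> r s \<le> dist t s \<Longrightarrow> w s t = 0"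
proof -
  have "C \<subseteq> (\<Union>s\<in>C. ball s (r s / 2))"
    using r by (force intro: centre_in_ball[THEN iffD2])
  then obtain J where J: "J \<subseteq> C" "finite J" "C \<subseteq> (\<Union>s\<in>J. ball s (r s / 2))"
    using compactE_image[OF \<open>compact C\<close>, of C "\<lambda>s. ball s (r s / 2)"] by blast
  \<comment> \<open>Tents are at least 1/2 on the half-size balls, and these still cover the compact set;
    this fixes the constant in the denominator of the weights.\<close>
  define b where "b s t = max 0 (1 - dist t s / r s)" for s t
  define B where "B t = (\<Sum>s\<in>J. b s t)" for t
  define w where "w s t = b s t / ((\<kappa> - 1) / 2 + B t)" for s t
  have b0: "0 \<le> b s t" for s t by (simp add: b_def)
  have B0: "0 \<le> B t" for t by (simp add: B_def sum_nonneg b0)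
  have den: "0 < (\<kappa> - 1) / 2 + B t" for t using \<open>1 < \<kappa>\<close> by (intro add_pos_nonneg B0) simp
  have rJ: "0 < r s" if "s \<in> J" for s using that J(1) r by auto
  have cb: "continuous_on UNIV (b s)" if "s \<in> J" for s
    unfolding b_def using rJ[OF that] by (intro continuous_intros) auto
  have sw: "(\<Sum>s\<in>J. w s t) = B t / ((\<kappa> - 1) / 2 + B t)" for t
    by (simp add: w_def B_def sum_divide_distrib)
  show thesis
  proof (rule that[OF J(2,1)])
    show "continuous_on UNIV (w s)" if "s \<in> J" for s
      unfolding w_def B_def using den cb that
      by (intro continuous_intros) (auto simp: B_def less_imp_neq[THEN not_sym])
    show "0 \<le> w s t" if "s \<in> J" for s t
      unfolding w_def using b0[of s t] den[of t] by simp
    show "(\<Sum>s\<in>J. w s t) \<le> 1" for t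
      unfolding sw using den[of t] \<open>1 < \<kappa>\<close> by (simp add: field_simps)
    show "1 \<le> \<kappa> * (\<Sum>s\<in>J. w s t)" if t: "t \<in> C" for t
    proof -
      obtain s where s: "s \<in> J" "dist t s < r s / 2"
        using subsetD[OF J(3) t] by (auto simp: dist_commute)
      have "1 / 2 \<le> b s t"
        using s rJ[OF s(1)] by (simp add: b_def field_simps)
      also have "\<dots> \<le> B t"
        unfolding B_def using s(1) J(2) b0 by (intro member_le_sum) auto
      finally have "(\<kappa> - 1) * (1 / 2) \<le> (\<kappa> - 1) * B t"
        using \<open>1 < \<kappa>\<close> by (intro mult_left_mono) auto
      then have "(\<kappa> - 1) / 2 + B t \<le> \<kappa> * B t"
        by (simp add: algebra_simps)
      then show ?thesis
        unfolding sw using den[of t] by (simp add: field_simps)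
    qed
    show "w s t = 0" if "s \<in> J" "r s \<le> dist t s" for s t
    proof -
      have "1 \<le> dist t s / r s"
        using that rJ[OF that(1)] by (simp add: field_simps)
      then show ?thesis by (simp add: w_def b_def)
    qed
  qed
qed

text \<open>
  One framework for both types of mixtures: for Type I the parameter is the pair of location and
  scale, for Type II it is the location, with the scale fixed.
\<close>

locale log_quadratic_kernel =
  fixes S :: "'s::{second_countable_topology, metric_space} set"
    and k :: "'s \<Rightarrow> 'x::euclidean_space \<Rightarrow> real"
    and a b :: "'s \<Rightarrow> real" and c :: "'s \<Rightarrow> 'x"
  assumes cont_a: "continuous_on S a" and cont_b: "continuous_on S b" and cont_c: "continuous_on S c"
    and kernel_eq: "s \<in> S \<Longrightarrow> k s x = exp (a s + b s * (norm x)\<^sup>2 + c s \<bullet> x)"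
    and kernel_mass: "s \<in> S \<Longrightarrow> (\<integral>\<^sup>+x. ennreal (k s x) \<partial>lborel) = 1"
begin

lemma kernel_pos: "s \<in> S \<Longrightarrow> 0 < k s x"
  by (simp add: kernel_eq)

lemma kernel_measurable:
  "(\<lambda>(x, s). k s x) \<in> borel_measurable (borel \<Otimes>\<^sub>M restrict_space borel S)"
proof -
  have [measurable]: "a \<in> borel_measurable (restrict_space borel S)"
    "b \<in> borel_measurable (restrict_space borel S)" "c \<in> borel_measurable (restrict_space borel S)"
    by (auto intro: borel_measurable_continuous_on_restrict cont_a cont_b cont_c)
  have "(\<lambda>(x, s). exp (a s + b s * (norm x)\<^sup>2 + c s \<bullet> x))
      \<in> borel_measurable (borel \<Otimes>\<^sub>M restrict_space borel S)"
    by measurable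
  then show ?thesis
    by (rule measurable_cong[THEN iffD1, rotated])
       (auto simp: space_pair_measure space_restrict_space kernel_eq)
qed

lemma kernel_lower_bound:
  assumes "compact C" "C \<subseteq> S"
  obtains A where "0 \<le> A" "\<And>s x. s \<in> C \<Longrightarrow> exp (- A * quad x) \<le> k s x"
proof -
  have "continuous_on C (\<lambda>s. \<bar>a s\<bar> + \<bar>b s\<bar> + norm (c s))"
    by (intro continuous_intros continuous_on_subset[OF _ assms(2)] cont_a cont_b cont_c)
  then have "bounded ((\<lambda>s. \<bar>a s\<bar> + \<bar>b s\<bar> + norm (c s)) ` C)"
    using assms(1) compact_continuous_image compact_imp_bounded by blast
  then obtain A where A: "0 < A" "\<And>s. s \<in> C \<Longrightarrow> \<bar>\<bar>a s\<bar> + \<bar>b s\<bar> + norm (c s)\<bar> \<le> A"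
    unfolding bounded_pos by auto
  show thesis
  proof (rule that[of A])
    fix s and x :: 'x assume s: "s \<in> C"
    have "(\<bar>a s\<bar> + \<bar>b s\<bar> + norm (c s)) * quad x \<le> A * quad x"
      using A(2)[OF s] quad_ge_1[of x] by (intro mult_right_mono) auto
    then have "- A * quad x \<le> a s + b s * (norm x)\<^sup>2 + c s \<bullet> x"
      using abs_log_quadratic_le[of "a s" "b s" x "c s"] by linarith
    then show "exp (- A * quad x) \<le> k s x"
      using s assms(2) by (simp add: kernel_eq subset_iff)
  qed (use A in simp)
qed

lemma kernel_locally_stable:
  assumes "s \<in> S" "0 < \<rho>"
  obtains r where "0 < r"
    "\<And>t x. t \<in> S \<Longrightarrow> dist t s < r \<Longrightarrow>
       k s x \<le> exp (\<rho> * quad x) * k t x \<and> k t x \<le> exp (\<rho> * quad x) * k s x"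
proof -
  have "0 < \<rho> / 3" using assms by simp
  obtain ra rb rc where r: "0 < ra" "0 < rb" "0 < rc"
    "\<And>t. t \<in> S \<Longrightarrow> dist t s < ra \<Longrightarrow> dist (a t) (a s) < \<rho> / 3"
    "\<And>t. t \<in> S \<Longrightarrow> dist t s < rb \<Longrightarrow> dist (b t) (b s) < \<rho> / 3"
    "\<And>t. t \<in> S \<Longrightarrow> dist t s < rc \<Longrightarrow> dist (c t) (c s) < \<rho> / 3"
    using cont_a cont_b cont_c \<open>0 < \<rho> / 3\<close> \<open>s \<in> S\<close> unfolding continuous_on_iff by metis
  show thesis
  proof (rule that[of "min ra (min rb rc)"])
    fix t and x :: 'x assume t: "t \<in> S" "dist t s < min ra (min rb rc)"
    have "\<bar>a t - a s\<bar> + \<bar>b t - b s\<bar> + norm (c t - c s) \<le> \<rho>"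
      using r(4-6)[OF t(1)] t(2) by (simp add: dist_norm)
    then have "(\<bar>a t - a s\<bar> + \<bar>b t - b s\<bar> + norm (c t - c s)) * quad x \<le> \<rho> * quad x"
      using quad_ge_1[of x] by (intro mult_right_mono) auto
    then have "\<bar>(a t - a s) + (b t - b s) * (norm x)\<^sup>2 + (c t - c s) \<bullet> x\<bar> \<le> \<rho> * quad x"
      using abs_log_quadratic_le[of "a t - a s" "b t - b s" x "c t - c s"] by linarith
    then show "k s x \<le> exp (\<rho> * quad x) * k t x \<and> k t x \<le> exp (\<rho> * quad x) * k s x"
      using t(1) assms(1)
      by (simp add: kernel_eq exp_add[symmetric] inner_diff_left left_diff_distrib abs_le_iff)
  qed (use r in auto)
qed

text \<open>
  On the support of each weight the kernel is constant up to a factor \<open>exp (\<rho>' * quad x)\<close>, so the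
  mixture over \<open>C\<close> is determined up to such factors by the finitely many integrals of the weights.
  The neighbourhood bounds these integrals from below by almost their values at \<open>P0\<close>; weights with
  integral zero are left out, since a strict lower bound would then exclude \<open>P0\<close> itself.
\<close>

lemma weak_neighbourhood_kernel_bound:
  assumes P0: "P0 \<in> prob_measures S" and C: "compact C" "C \<subseteq> S" and "0 < \<rho>"
  obtains U where "openin (weak_topology S) U" "P0 \<in> U"
    "\<And>P x. P \<in> U \<Longrightarrow>
       ennreal (exp (- \<rho> * quad x)) * (\<integral>\<^sup>+s. ennreal (k s x) * indicator C s \<partial>P0) \<le> (\<integral>\<^sup>+s. ennreal (k s x) \<partial>P)"
proof -
  \<comment> \<open>Four factors \<open>exp (\<rho>' * quad x)\<close> are lost: one for the weights
    summing to less than one on \<open>C\<close>, one for the strict inequalities that define the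
    neighbourhood, and two for moving the parameter to the centre of a ball and back.\<close>
  define \<rho>' where "\<rho>' = \<rho> / 4"
  have \<rho>': "0 < \<rho>'" using \<open>0 < \<rho>\<close> by (simp add: \<rho>'_def)
  have "\<exists>r>0. \<forall>t x. t \<in> S \<longrightarrow> dist t s < r \<longrightarrow>
       k s x \<le> exp (\<rho>' * quad x) * k t x \<and> k t x \<le> exp (\<rho>' * quad x) * k s x" if "s \<in> C" for s
    by (rule kernel_locally_stable[OF _ \<rho>', of s]) (use that C(2) in auto)
  then obtain r where "\<forall>s\<in>C. 0 < r s \<and> (\<forall>t x. t \<in> S \<longrightarrow> dist t s < r s \<longrightarrow>
       k s x \<le> exp (\<rho>' * quad x) * k t x \<and> k t x \<le> exp (\<rho>' * quad x) * k s x)"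
    by metis
  then have r: "\<And>s. s \<in> C \<Longrightarrow> 0 < r s"
    "\<And>s t x. s \<in> C \<Longrightarrow> t \<in> S \<Longrightarrow> dist t s < r s \<Longrightarrow> k s x \<le> exp (\<rho>' * quad x) * k t x"
    "\<And>s t x. s \<in> C \<Longrightarrow> t \<in> S \<Longrightarrow> dist t s < r s \<Longrightarrow> k t x \<le> exp (\<rho>' * quad x) * k s x"
    by auto
  obtain J w where J: "finite J" "J \<subseteq> C"
    and w: "\<And>s. s \<in> J \<Longrightarrow> continuous_on UNIV (w s)"
      "\<And>s t. s \<in> J \<Longrightarrow> 0 \<le> w s t"
      "\<And>t. (\<Sum>s\<in>J. w s t) \<le> 1"
      "\<And>t. t \<in> C \<Longrightarrow> 1 \<le> exp \<rho>' * (\<Sum>s\<in>J. w s t)"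
      "\<And>s t. s \<in> J \<Longrightarrow> r s \<le> dist t s \<Longrightarrow> w s t = 0"
    using weights_on_compact[of C r "exp \<rho>'"] C(1) r(1) \<rho>' by auto
  have w1: "w s t \<le> 1" if "s \<in> J" for s t
    using member_le_sum[of s J "\<lambda>s. w s t"] that w(2,3) J(1) by (meson Diff_iff order_trans)
  have wm: "w s \<in> borel_measurable borel" if "s \<in> J" for s
    using w(1)[OF that] by (rule borel_measurable_continuous_onI)
  have meas: "sets P = sets (restrict_space borel S)" "space P = S" "prob_space P"
    if "P \<in> prob_measures S" for P
    using that sets_eq_imp_space_eq[of P "restrict_space borel S"]
    by (auto simp: prob_measures_def space_prob_algebra space_restrict_space)
  have wmP: "w s \<in> borel_measurable P" if "s \<in> J" "P \<in> prob_measures S" for s P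
    using measurable_restrict_space1[OF wm[OF that(1)], of S]
    by (simp cong: measurable_cong_sets add: meas(1)[OF that(2)])
  have nn_w: "(\<integral>\<^sup>+t. ennreal (w s t) \<partial>P) = ennreal (\<integral>t. w s t \<partial>P)"
    if "s \<in> J" "P \<in> prob_measures S" for s P
  proof (rule nn_integral_eq_integral)
    interpret prob_space P using meas that by simp
    show "integrable P (w s)"
      by (rule integrable_const_bound[of _ 1]) (use that w1 w(2) wmP in auto)
  qed (use that w(2) in auto)
  have int_w0: "0 \<le> (\<integral>t. w s t \<partial>P)" if "s \<in> J" for s P
    using that w(2) by (intro Bochner_Integration.integral_nonneg) auto
  define I where "I = {s \<in> J. 0 < (\<integral>t. w s t \<partial>P0)}"
  define V where "V s = {exp (- \<rho>') * (\<integral>t. w s t \<partial>P0) <..}" for s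
  define U where "U = (\<Inter>s\<in>I. {P \<in> prob_measures S. (\<integral>t. w s t \<partial>P) \<in> V s}) \<inter> topspace (weak_topology S)"
  have bnd: "(\<integral>t. w s t \<partial>P0) \<le> exp \<rho>' * (\<integral>t. w s t \<partial>P)" if "P \<in> U" "s \<in> J" for P s
  proof (cases "s \<in> I")
    case True
    with that have "exp (- \<rho>') * (\<integral>t. w s t \<partial>P0) < (\<integral>t. w s t \<partial>P)"
      by (auto simp: U_def V_def)
    then show ?thesis by (simp add: exp_minus field_simps)
  next
    case False
    with that int_w0[OF that(2), of P0] int_w0[OF that(2), of P] show ?thesis
      by (simp add: I_def)
  qed
  show thesis
  proof (rule that)
    have "openin (weak_topology S) {P \<in> prob_measures S. (\<integral>t. w s t \<partial>P) \<in> V s}" if "s \<in> I" for s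
      unfolding weak_topology_def
    proof (rule topology_generated_by_Basis)
      have "continuous_on S (w s)"
        using w(1) that by (auto simp: I_def intro: continuous_on_subset[OF _ subset_UNIV])
      moreover have "bounded (w s ` S)"
        using that w1 w(2) by (auto simp: bounded_iff I_def intro!: exI[of _ 1])
      moreover have "open (V s)"
        by (simp add: V_def)
      ultimately show "{P \<in> prob_measures S. (\<integral>t. w s t \<partial>P) \<in> V s} \<in>
          {{P \<in> prob_measures S. (\<integral>s. g s \<partial>P) \<in> V} | (g :: 's \<Rightarrow> real) V.
            continuous_on S g \<and> bounded (g ` S) \<and> open V}"
        by blast
    qed
    then show "openin (weak_topology S) U"
      unfolding U_def using J(1) by (intro openin_INT) (auto simp: I_def)
    have "exp (- \<rho>') * y < y" if "0 < y" for y :: real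
      using that \<rho>' by simp
    then show "P0 \<in> U"
      using P0 by (auto simp: U_def V_def I_def topspace_weak_topology)
    fix P and x :: 'x assume PU: "P \<in> U"
    then have P: "P \<in> prob_measures S" by (simp add: U_def topspace_weak_topology)
    define E where "E = exp (\<rho>' * quad x)"
    have E: "0 < E" "exp \<rho>' \<le> E"
      using mult_left_mono[OF quad_ge_1, of \<rho>' x] \<rho>' by (auto simp: E_def)
    have E4: "exp (- \<rho> * quad x) * (E * E * E * E) = 1"
      by (simp add: E_def exp_add[symmetric] \<rho>'_def)
    have k0: "0 \<le> k s x" if "s \<in> S" for s using kernel_pos[OF that, of x] by simp
    have kJ: "0 \<le> k s x" if "s \<in> J" for s using that J C(2) k0 by blast
    have up: "k t x * indicator C t \<le> (\<Sum>s\<in>J. E * E * k s x * w s t)" if "t \<in> S" for t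
    proof (cases "t \<in> C")
      case True
      have "k t x * 1 \<le> k t x * (E * (\<Sum>s\<in>J. w s t))"
        using w(4)[OF True] E w(2) k0[OF that]
        by (intro mult_left_mono order_trans[OF w(4)[OF True]] mult_right_mono sum_nonneg) auto
      also have "\<dots> = (\<Sum>s\<in>J. E * (k t x * w s t))"
        by (simp add: sum_distrib_left mult_ac)
      also have "\<dots> \<le> (\<Sum>s\<in>J. E * (E * k s x * w s t))"
      proof (intro sum_mono mult_left_mono)
        fix s assume s: "s \<in> J"
        show "k t x * w s t \<le> E * k s x * w s t"
        proof (cases "dist t s < r s")
          case True
          then show ?thesis
            unfolding E_def using r(3)[of s t x] s J that w(2) by (intro mult_right_mono) auto
        qed (use w(5) s in auto)
      qed (use E in auto)
      finally show ?thesis using True by (simp add: mult_ac)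
    qed (use E kJ w(2) in \<open>auto intro!: sum_nonneg\<close>)
    have lo: "(\<Sum>s\<in>J. k s x * w s t) \<le> E * k t x" if "t \<in> S" for t
    proof -
      have "(\<Sum>s\<in>J. k s x * w s t) \<le> (\<Sum>s\<in>J. E * k t x * w s t)"
      proof (intro sum_mono)
        fix s assume s: "s \<in> J"
        show "k s x * w s t \<le> E * k t x * w s t"
        proof (cases "dist t s < r s")
          case True
          then show ?thesis
            unfolding E_def using r(2)[of s t x] s J that w(2) by (intro mult_right_mono) auto
        qed (use w(5) s in auto)
      qed
      also have "\<dots> = E * k t x * (\<Sum>s\<in>J. w s t)" by (simp add: sum_distrib_left)
      also have "\<dots> \<le> E * k t x * 1"
        using w(3) E k0[OF that] by (intro mult_left_mono) auto
      finally show ?thesis by simp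
    qed
    have swap: "(\<integral>\<^sup>+t. ennreal (\<Sum>s\<in>J. y s * w s t) \<partial>Q) = ennreal (\<Sum>s\<in>J. y s * (\<integral>t. w s t \<partial>Q))"
      if Q: "Q \<in> prob_measures S" and y: "\<And>s. s \<in> J \<Longrightarrow> 0 \<le> y s" for Q y
    proof -
      have "(\<integral>\<^sup>+t. ennreal (\<Sum>s\<in>J. y s * w s t) \<partial>Q) = (\<integral>\<^sup>+t. (\<Sum>s\<in>J. ennreal (y s) * ennreal (w s t)) \<partial>Q)"
        using y w(2) by (intro nn_integral_cong) (simp add: sum_ennreal[symmetric] ennreal_mult' del: sum_ennreal)
      also have "\<dots> = (\<Sum>s\<in>J. ennreal (y s) * (\<integral>\<^sup>+t. ennreal (w s t) \<partial>Q))"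
        using wmP[OF _ Q] by (subst nn_integral_sum) (auto simp: nn_integral_cmult)
      also have "\<dots> = ennreal (\<Sum>s\<in>J. y s * (\<integral>t. w s t \<partial>Q))"
        using y int_w0 nn_w[OF _ Q] by (simp add: sum_ennreal[symmetric] ennreal_mult del: sum_ennreal)
      finally show ?thesis .
    qed
    have "(\<integral>\<^sup>+s. ennreal (k s x) * indicator C s \<partial>P0) = (\<integral>\<^sup>+s. ennreal (k s x * indicator C s) \<partial>P0)"
      by (intro nn_integral_cong) (auto simp: indicator_def)
    also have "\<dots> \<le> (\<integral>\<^sup>+t. ennreal (\<Sum>s\<in>J. E * E * k s x * w s t) \<partial>P0)"
      using up meas(2)[OF P0] by (intro nn_integral_mono ennreal_leI) auto
    also have "\<dots> = ennreal (\<Sum>s\<in>J. E * E * k s x * (\<integral>t. w s t \<partial>P0))"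
      using swap[OF P0, of "\<lambda>s. E * E * k s x"] E kJ by simp
    also have "\<dots> \<le> ennreal (\<Sum>s\<in>J. E * E * k s x * (E * (\<integral>t. w s t \<partial>P)))"
    proof (intro ennreal_leI sum_mono mult_left_mono)
      fix s assume s: "s \<in> J"
      show "(\<integral>t. w s t \<partial>P0) \<le> E * (\<integral>t. w s t \<partial>P)"
        using bnd[OF PU s] mult_right_mono[OF E(2) int_w0[OF s, of P]] by linarith
    qed (use E kJ in auto)
    also have "\<dots> = ennreal (E * E * E) * (\<integral>\<^sup>+t. ennreal (\<Sum>s\<in>J. k s x * w s t) \<partial>P)"
      using E kJ int_w0 by (subst swap[OF P]) (auto simp: ennreal_mult[symmetric] sum_nonneg sum_distrib_left mult_ac)
    also have "\<dots> \<le> ennreal (E * E * E) * (\<integral>\<^sup>+t. ennreal (E * k t x) \<partial>P)"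
      using lo meas(2)[OF P] by (intro mult_left_mono nn_integral_mono ennreal_leI) auto
    also have "(\<integral>\<^sup>+t. ennreal (E * k t x) \<partial>P) = ennreal E * (\<integral>\<^sup>+t. ennreal (k t x) \<partial>P)"
    proof -
      have "(\<lambda>s. k s x) \<in> borel_measurable (restrict_space borel S)"
        using measurable_compose[OF measurable_Pair1'[of x borel] kernel_measurable] by simp
      then have "(\<lambda>s. k s x) \<in> borel_measurable P"
        by (simp cong: measurable_cong_sets add: meas(1)[OF P])
      then show ?thesis
        using E by (simp add: ennreal_mult' nn_integral_cmult)
    qed
    finally have "(\<integral>\<^sup>+s. ennreal (k s x) * indicator C s \<partial>P0)
        \<le> ennreal (E * E * E * E) * (\<integral>\<^sup>+t. ennreal (k t x) \<partial>P)"
      using E by (simp add: ennreal_mult' mult_ac)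
    then have "ennreal (exp (- \<rho> * quad x)) * (\<integral>\<^sup>+s. ennreal (k s x) * indicator C s \<partial>P0)
        \<le> ennreal (exp (- \<rho> * quad x)) * (ennreal (E * E * E * E) * (\<integral>\<^sup>+t. ennreal (k t x) \<partial>P))"
      by (rule mult_left_mono) simp
    also have "\<dots> = (\<integral>\<^sup>+t. ennreal (k t x) \<partial>P)"
      unfolding mult.assoc[symmetric] using E E4 by (subst ennreal_mult[symmetric]) auto
    finally show "ennreal (exp (- \<rho> * quad x)) * (\<integral>\<^sup>+s. ennreal (k s x) * indicator C s \<partial>P0)
        \<le> (\<integral>\<^sup>+s. ennreal (k s x) \<partial>P)" .
  qed
qed

end

section \<open>Infima over small balls\<close>

definition ball_inf :: "('a::real_normed_vector \<Rightarrow> real) \<Rightarrow> real \<Rightarrow> 'a \<Rightarrow> real" where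
  "ball_inf f r x = (INF t\<in>{t. norm (t - x) < r}. f t)"

context
  fixes f :: "'a::euclidean_space \<Rightarrow> real"
  assumes f_cont: "continuous_on UNIV f" and f_pos: "\<And>x. 0 < f x"
begin

lemma ball_inf_bdd: "bdd_below (f ` A)"
  using f_pos by (intro bdd_belowI2[of _ 0]) (simp add: less_imp_le)

lemma ball_inf_le: "norm (t - x) < r \<Longrightarrow> ball_inf f r x \<le> f t"
  unfolding ball_inf_def by (rule cINF_lower) (auto intro: ball_inf_bdd)

lemma ball_inf_pos:
  assumes "0 < r"
  shows "0 < ball_inf f r x"
proof -
  obtain t0 where "\<And>t. t \<in> cball x r \<Longrightarrow> f t0 \<le> f t"
    using continuous_attains_inf[OF compact_cball _ continuous_on_subset[OF f_cont subset_UNIV], of x r] assms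
    by force
  then have "f t0 \<le> ball_inf f r x"
    unfolding ball_inf_def using assms
    by (intro cINF_greatest) (auto simp: dist_norm norm_minus_commute intro!: exI[of _ x])
  then show ?thesis using f_pos[of t0] by linarith
qed

lemma ball_inf_mono: "0 < r \<Longrightarrow> r \<le> r' \<Longrightarrow> ball_inf f r' x \<le> ball_inf f r x"
  unfolding ball_inf_def
  by (rule cINF_superset_mono) (auto intro: ball_inf_bdd exI[of _ x])

text \<open>
  As a function of the centre, the infimum over open balls is upper semicontinuous.
\<close>

lemma borel_measurable_ball_inf:
  assumes "0 < r"
  shows "ball_inf f r \<in> borel_measurable borel"
proof (rule borel_measurable_iff_less[THEN iffD2, rule_format])
  fix y
  have "{x. ball_inf f r x < y} = (\<Union>t\<in>{t. f t < y}. ball t r)"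
  proof -
    have "ball_inf f r x < y \<longleftrightarrow> (\<exists>t\<in>{t. norm (t - x) < r}. f t < y)" for x
      unfolding ball_inf_def using assms
      by (intro cINF_less_iff) (auto intro: ball_inf_bdd exI[of _ x])
    then show ?thesis by (auto simp: dist_norm)
  qed
  moreover have "open (\<Union>t\<in>{t. f t < y}. ball t r)" by auto
  ultimately show "{x \<in> space borel. ball_inf f r x < y} \<in> sets borel" by simp
qed

lemma ball_inf_tendsto:
  assumes "0 < \<delta>"
  shows "(\<lambda>n. ball_inf f (\<delta> / Suc n) x) \<longlonglongrightarrow> f x"
proof (rule LIMSEQ_I)
  fix e :: real assume "0 < e"
  then obtain d where d: "0 < d" "\<And>t. dist t x < d \<Longrightarrow> dist (f t) (f x) < e / 2"
    using f_cont[unfolded continuous_on_iff, rule_format, of x "e / 2"] by auto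
  have "(\<lambda>n. \<delta> / real (Suc n)) \<longlonglongrightarrow> 0"
    by (intro real_tendsto_divide_at_top[OF tendsto_const]
        filterlim_compose[OF filterlim_real_sequentially filterlim_Suc])
  then have "eventually (\<lambda>n. \<delta> / real (Suc n) < d) sequentially"
    using d(1) by (rule order_tendstoD)
  then obtain N where N: "\<And>n. N \<le> n \<Longrightarrow> \<delta> / real (Suc n) < d"
    unfolding eventually_sequentially by blast
  have "norm (ball_inf f (\<delta> / real (Suc n)) x - f x) < e" if "N \<le> n" for n
  proof -
    have r: "0 < \<delta> / real (Suc n)" using assms by simp
    have "f x - e / 2 \<le> ball_inf f (\<delta> / real (Suc n)) x"
      unfolding ball_inf_def
    proof (rule cINF_greatest)
      show "{t. norm (t - x) < \<delta> / real (Suc n)} \<noteq> {}"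
        using r by (auto intro!: exI[of _ x])
      fix t assume "t \<in> {t. norm (t - x) < \<delta> / real (Suc n)}"
      then have "dist (f t) (f x) < e / 2"
        using d(2)[of t] N[OF that] by (simp add: dist_norm)
      then show "f x - e / 2 \<le> f t" unfolding dist_real_def by linarith
    qed
    moreover have "ball_inf f (\<delta> / real (Suc n)) x \<le> f x"
      using ball_inf_le[of x x] r by simp
    ultimately show ?thesis using \<open>0 < e\<close> by simp
  qed
  then show "\<exists>N. \<forall>n\<ge>N. norm (ball_inf f (\<delta> / real (Suc n)) x - f x) < e" by blast
qed

text \<open>
  The infima increase to \<open>f\<close> as the radius shrinks, so the integrands are nonnegative and dominated
  by the one for the radius \<open>\<delta>\<close>.
\<close>

lemma ball_inf_divergence_small:
  assumes "0 < \<delta>" and int: "integrable lborel (\<lambda>x. f x * ln (f x / ball_inf f \<delta> x))" and "0 < \<epsilon>"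
  obtains r where "0 < r"
    "integrable lborel (\<lambda>x. f x * ln (f x / ball_inf f r x))"
    "(\<integral>x. f x * ln (f x / ball_inf f r x) \<partial>lborel) < \<epsilon>"
proof -
  define g where "g n x = f x * ln (f x / ball_inf f (\<delta> / Suc n) x)" for n x
  have r: "0 < \<delta> / real (Suc n)" "\<delta> / real (Suc n) \<le> \<delta>" for n
    using assms(1) by (auto simp: field_simps)
  have [measurable]: "f \<in> borel_measurable borel"
    using f_cont by (rule borel_measurable_continuous_onI)
  have [measurable]: "ball_inf f (\<delta> / Suc n) \<in> borel_measurable borel" for n
    using r(1) by (rule borel_measurable_ball_inf)
  have meas: "g n \<in> borel_measurable lborel" for n
    unfolding g_def by measurable
  have lim: "AE x in lborel. (\<lambda>n. g n x) \<longlonglongrightarrow> 0"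
  proof (rule AE_I2)
    fix x
    have "(\<lambda>n. g n x) \<longlonglongrightarrow> f x * ln (f x / f x)"
      unfolding g_def using f_pos[of x] less_imp_neq[OF f_pos[of x]]
      by (intro tendsto_intros ball_inf_tendsto assms(1)) auto
    then show "(\<lambda>n. g n x) \<longlonglongrightarrow> 0"
      using f_pos[of x] by simp
  qed
  have bound: "AE x in lborel. norm (g n x) \<le> f x * ln (f x / ball_inf f \<delta> x)" for n
  proof (rule AE_I2)
    fix x
    note p = f_pos[of x] ball_inf_pos[OF r(1), of n x] ball_inf_pos[OF assms(1), of x]
    have "ball_inf f (\<delta> / Suc n) x \<le> f x"
      using ball_inf_le[of x x "\<delta> / Suc n"] r(1)[of n] by simp
    then have "0 \<le> ln (f x / ball_inf f (\<delta> / Suc n) x)"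
      using p by simp
    moreover have "ln (f x / ball_inf f (\<delta> / Suc n) x) \<le> ln (f x / ball_inf f \<delta> x)"
      using ball_inf_mono[OF r(1)[of n] r(2)[of n], of x] p by (simp add: frac_le)
    ultimately show "norm (g n x) \<le> f x * ln (f x / ball_inf f \<delta> x)"
      using p by (simp add: g_def abs_mult)
  qed
  have gi: "integrable lborel (g n)" for n
    by (rule Bochner_Integration.integrable_bound[OF int meas])
       (use bound[of n] in \<open>auto elim!: eventually_mono\<close>)
  have "(\<lambda>n. \<integral>x. g n x \<partial>lborel) \<longlonglongrightarrow> (\<integral>x. 0 \<partial>(lborel :: 'a measure))"
    using meas lim bound by (intro integral_dominated_convergence[OF _ _ int]) auto
  then have "eventually (\<lambda>n. (\<integral>x. g n x \<partial>lborel) < \<epsilon>) sequentially"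
    using \<open>0 < \<epsilon>\<close> by (intro order_tendstoD) auto
  then obtain n where "(\<integral>x. g n x \<partial>lborel) < \<epsilon>"
    unfolding eventually_sequentially by blast
  then show thesis
    using that[of "\<delta> / Suc n"] r(1) gi[of n] unfolding g_def by auto
qed

end

section \<open>Location-scale kernels\<close>

lemma nn_integral_lborel_affine:
  fixes g :: "'a::euclidean_space \<Rightarrow> ennreal"
  assumes [measurable]: "g \<in> borel_measurable borel" and "u \<noteq> 0"
  shows "(\<integral>\<^sup>+x. g x \<partial>lborel) = ennreal (\<bar>u\<bar> ^ DIM('a)) * (\<integral>\<^sup>+x. g (t + u *\<^sub>R x) \<partial>lborel)"
  by (subst lborel_affine[OF assms(2), of t])
     (simp add: nn_integral_density nn_integral_distr nn_integral_cmult)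

lemma normal_kernel_eq_exp:
  fixes x :: "real ^ 'n"
  shows "normal_kernel x = exp (- (real CARD('n) / 2) * ln (2 * pi) - (norm x)\<^sup>2 / 2)"
proof -
  have "(norm x)\<^sup>2 = (\<Sum>i\<in>UNIV. (x $ i)\<^sup>2)"
    unfolding power2_norm_eq_inner inner_vec_def by (simp add: power2_eq_square)
  then have "(\<Prod>i\<in>UNIV. exp (- (x $ i)\<^sup>2 / 2)) = exp (- (norm x)\<^sup>2 / 2)"
    by (simp add: exp_sum[symmetric] sum_negf sum_divide_distrib)
  then show ?thesis
    by (simp add: normal_kernel_def powr_def exp_add[symmetric])
qed

lemma normal_kernel_pos: "0 < normal_kernel x"
  by (simp add: normal_kernel_eq_exp)

lemma borel_measurable_normal_kernel [measurable]: "normal_kernel \<in> borel_measurable borel"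
  unfolding normal_kernel_eq_exp[abs_def] by measurable

lemma nn_integral_normal_kernel:
  "(\<integral>\<^sup>+x. ennreal (normal_kernel (x :: real ^ 'n)) \<partial>lborel) = 1"
proof -
  have B: "(Basis :: (real ^ 'n) set) = range (\<lambda>i. axis i 1)"
    by (auto simp: Basis_vec_def)
  have inj: "inj (\<lambda>i::'n. axis i (1::real))"
    by (auto simp: inj_on_def axis_eq_axis)
  have one: "(\<integral>\<^sup>+y. ennreal (std_normal_density y) \<partial>lborel) = 1"
    using prob_space.emeasure_space_1[OF prob_space_normal_density[of 1 0]]
    by (simp add: emeasure_density)
  have "normal_kernel x = (\<Prod>b\<in>Basis. std_normal_density (x \<bullet> b))" for x :: "real ^ 'n"
  proof -
    have "(\<Prod>b\<in>Basis. std_normal_density (x \<bullet> b)) = (\<Prod>i\<in>UNIV. std_normal_density (x $ i))"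
      unfolding B by (simp add: prod.reindex[OF inj] inner_axis)
    also have "\<dots> = (1 / sqrt (2 * pi)) ^ CARD('n) * (\<Prod>i\<in>UNIV. exp (- (x $ i)\<^sup>2 / 2))"
      by (simp add: std_normal_density_def prod.distrib prod_dividef power_divide)
    also have "(1 / sqrt (2 * pi)) ^ CARD('n) = (2 * pi) powr (- real CARD('n) / 2)"
    proof -
      have "1 / sqrt (2 * pi) = (2 * pi) powr (- 1 / 2)"
        by (simp add: powr_minus_divide powr_half_sqrt)
      then show ?thesis
        by (simp add: powr_realpow[symmetric] powr_powr)
    qed
    finally show ?thesis by (simp add: normal_kernel_def)
  qed
  then have "(\<integral>\<^sup>+x. ennreal (normal_kernel (x :: real ^ 'n)) \<partial>lborel)
      = (\<integral>\<^sup>+x. (\<Prod>b\<in>Basis. ennreal (std_normal_density ((x :: real ^ 'n) \<bullet> b))) \<partial>lborel)"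
    by (simp add: prod_ennreal)
  also have "\<dots> = 1"
    by (subst nn_integral_lborel_prod) (auto simp: one)
  finally show ?thesis .
qed

lemma nn_integral_loc_scale:
  fixes K :: "real ^ 'n \<Rightarrow> real"
  assumes [measurable]: "K \<in> borel_measurable borel" and "0 < \<phi>"
  shows "(\<integral>\<^sup>+x. ennreal (loc_scale K \<theta> \<phi> x) \<partial>lborel) = (\<integral>\<^sup>+x. ennreal (K x) \<partial>lborel)"
proof -
  have [measurable]: "(\<lambda>x. loc_scale K \<theta> \<phi> x) \<in> borel_measurable borel"
    unfolding loc_scale_def by measurable
  have "(\<integral>\<^sup>+x. ennreal (loc_scale K \<theta> \<phi> x) \<partial>lborel)
      = ennreal (\<phi> ^ CARD('n)) * (\<integral>\<^sup>+x. ennreal (loc_scale K \<theta> \<phi> (\<theta> + \<phi> *\<^sub>R x)) \<partial>lborel)"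
    using nn_integral_lborel_affine[of "\<lambda>x. ennreal (loc_scale K \<theta> \<phi> x)" \<phi> \<theta>] assms(2) by simp
  also have "\<dots> = (\<integral>\<^sup>+x. ennreal (\<phi> ^ CARD('n)) * ennreal (loc_scale K \<theta> \<phi> (\<theta> + \<phi> *\<^sub>R x)) \<partial>lborel)"
    by (subst nn_integral_cmult) (auto simp: loc_scale_def)
  also have "\<dots> = (\<integral>\<^sup>+x. ennreal (K x) \<partial>lborel)"
    using assms(2) by (intro nn_integral_cong) (simp add: loc_scale_def ennreal_mult'[symmetric])
  finally show ?thesis .
qed

text \<open>
  The substitution \<open>\<theta> = x - \<phi> * z\<close> makes the integral independent of \<open>x\<close>: it is the mass of \<open>K\<close> in
  the ball of radius \<open>r / \<phi>\<close> about the origin.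
\<close>

lemma loc_scale_concentrates:
  fixes K :: "real ^ 'n \<Rightarrow> real"
  assumes [measurable]: "K \<in> borel_measurable borel"
    and mass: "(\<integral>\<^sup>+x. ennreal (K x) \<partial>lborel) = 1" and "0 < r" and "y < 1"
  obtains \<phi>0 where "0 < \<phi>0"
    "\<And>\<phi> x. 0 < \<phi> \<Longrightarrow> \<phi> < \<phi>0 \<Longrightarrow>
       ennreal y \<le> (\<integral>\<^sup>+\<theta>. ennreal (loc_scale K \<theta> \<phi> x) * indicator {\<theta>. norm (\<theta> - x) < r} \<theta> \<partial>lborel)"
proof -
  define D where "D = density lborel (\<lambda>x. ennreal (K x))"
  have "(\<lambda>n. emeasure D (ball 0 (real (Suc n)))) \<longlonglongrightarrow> emeasure D (\<Union>n. ball 0 (real (Suc n)))"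
  proof (rule Lim_emeasure_incseq)
    show "incseq (\<lambda>n. ball (0 :: real ^ 'n) (real (Suc n)))"
      by (auto simp: incseq_def)
  qed (auto simp: D_def)
  moreover have "(\<Union>n. ball (0 :: real ^ 'n) (real (Suc n))) = UNIV"
  proof -
    have "\<exists>n. norm x < real (Suc n)" for x :: "real ^ 'n"
      using reals_Archimedean2[of "norm x"] by (meson lessI less_trans of_nat_less_iff)
    then show ?thesis by auto
  qed
  moreover have "emeasure D UNIV = 1"
    using mass by (simp add: D_def emeasure_density)
  moreover have "ennreal y < 1"
    using \<open>y < 1\<close> by (simp add: ennreal_less_one_iff)
  ultimately have "eventually (\<lambda>n. ennreal y < emeasure D (ball 0 (real (Suc n)))) sequentially"
    by (auto dest!: order_tendstoD(1))
  then obtain n where n: "ennreal y < emeasure D (ball 0 (real (Suc n)))"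
    unfolding eventually_sequentially by blast
  show thesis
  proof (rule that[of "r / real (Suc n)"])
    show "0 < r / real (Suc n)" using \<open>0 < r\<close> by simp
    fix \<phi> and x :: "real ^ 'n" assume \<phi>: "0 < \<phi>" "\<phi> < r / real (Suc n)"
    define g where "g \<theta> = ennreal (loc_scale K \<theta> \<phi> x) * indicator {\<theta>. norm (\<theta> - x) < r} \<theta>" for \<theta>
    have [measurable]: "g \<in> borel_measurable borel"
      unfolding g_def loc_scale_def by measurable
    have "ball 0 (real (Suc n)) \<subseteq> {z :: real ^ 'n. \<phi> * norm z < r}"
    proof safe
      fix z :: "real ^ 'n" assume "z \<in> ball 0 (real (Suc n))"
      then have "\<phi> * norm z < \<phi> * real (Suc n)" using \<phi> by simp
      also have "\<dots> < r" using \<phi> by (simp add: field_simps)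
      finally show "\<phi> * norm z < r" .
    qed
    then have "emeasure D (ball 0 (real (Suc n))) \<le> emeasure D {z. \<phi> * norm z < r}"
      by (rule emeasure_mono) (simp add: D_def)
    also have "\<dots> = (\<integral>\<^sup>+z. ennreal (K z) * indicator {z. \<phi> * norm z < r} z \<partial>lborel)"
      by (simp add: D_def emeasure_density)
    also have "\<dots> = (\<integral>\<^sup>+z. ennreal (\<phi> ^ CARD('n)) * g (x + (- \<phi>) *\<^sub>R z) \<partial>lborel)"
      using \<phi> by (intro nn_integral_cong)
        (auto simp: g_def loc_scale_def ennreal_mult'[symmetric] indicator_def)
    also have "\<dots> = (\<integral>\<^sup>+\<theta>. g \<theta> \<partial>lborel)"
      using nn_integral_lborel_affine[of g "- \<phi>" x] \<phi> by (simp add: nn_integral_cmult)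
    finally show "ennreal y \<le> (\<integral>\<^sup>+\<theta>. ennreal (loc_scale K \<theta> \<phi> x) * indicator {\<theta>. norm (\<theta> - x) < r} \<theta> \<partial>lborel)"
      using n by (simp add: g_def)
  qed
qed

abbreviation normal_log_const :: "real ^ 'n \<Rightarrow> real \<Rightarrow> real" where
  "normal_log_const \<theta> \<phi> \<equiv>
     - (real CARD('n) / 2) * ln (2 * pi) - real CARD('n) * ln \<phi> - (norm \<theta>)\<^sup>2 / (2 * \<phi>\<^sup>2)"

lemma loc_scale_normal_kernel_eq_exp:
  fixes x \<theta> :: "real ^ 'n"
  assumes "0 < \<phi>"
  shows "loc_scale normal_kernel \<theta> \<phi> x =
    exp (normal_log_const \<theta> \<phi>
      + (- 1 / (2 * \<phi>\<^sup>2)) * (norm x)\<^sup>2 + ((1 / \<phi>\<^sup>2) *\<^sub>R \<theta>) \<bullet> x)"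
proof -
  have p: "1 / \<phi> ^ CARD('n) = exp (- (real CARD('n) * ln \<phi>))"
    using assms by (simp add: exp_minus exp_of_nat_mult inverse_eq_divide)
  have q: "(norm ((1 / \<phi>) *\<^sub>R (x - \<theta>)))\<^sup>2 = ((norm x)\<^sup>2 - 2 * (\<theta> \<bullet> x) + (norm \<theta>)\<^sup>2) / \<phi>\<^sup>2"
    using assms
    by (simp add: power_mult_distrib power2_norm_eq_inner inner_diff inner_commute power_divide)
  show ?thesis
    unfolding loc_scale_def normal_kernel_eq_exp p q exp_add[symmetric]
    using assms by (simp add: field_simps)
qed

lemma log_quadratic_kernel_type_I:
  "log_quadratic_kernel (UNIV \<times> {0<..}) (\<lambda>s. loc_scale normal_kernel (fst s) (snd s))
     (\<lambda>s. normal_log_const (fst s) (snd s))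
     (\<lambda>s. - 1 / (2 * (snd s)\<^sup>2)) (\<lambda>s. (1 / (snd s)\<^sup>2) *\<^sub>R (fst s :: real ^ 'n))"
proof (rule log_quadratic_kernel.intro)
  show "loc_scale normal_kernel (fst s) (snd s) x = exp
      (normal_log_const (fst s) (snd s)
       + (- 1 / (2 * (snd s)\<^sup>2)) * (norm x)\<^sup>2 + ((1 / (snd s)\<^sup>2) *\<^sub>R fst s) \<bullet> x)"
    if "s \<in> UNIV \<times> {0<..}" for s and x :: "real ^ 'n"
    using that by (intro loc_scale_normal_kernel_eq_exp) auto
  show "(\<integral>\<^sup>+x. ennreal (loc_scale normal_kernel (fst s) (snd s) x) \<partial>lborel) = 1"
    if "s \<in> UNIV \<times> {0<..}" for s :: "(real ^ 'n) \<times> real"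
    using that by (auto simp: nn_integral_loc_scale nn_integral_normal_kernel)
qed (intro continuous_intros; auto)+

lemma log_quadratic_kernel_type_II:
  assumes "0 < \<phi>"
  shows "log_quadratic_kernel UNIV (\<lambda>\<theta>. loc_scale normal_kernel \<theta> \<phi>)
     (\<lambda>\<theta>. normal_log_const \<theta> \<phi>)
     (\<lambda>\<theta>. - 1 / (2 * \<phi>\<^sup>2)) (\<lambda>\<theta>. (1 / \<phi>\<^sup>2) *\<^sub>R (\<theta> :: real ^ 'n))"
proof (rule log_quadratic_kernel.intro)
  show "loc_scale normal_kernel \<theta> \<phi> x = exp
      (normal_log_const \<theta> \<phi>
       + (- 1 / (2 * \<phi>\<^sup>2)) * (norm x)\<^sup>2 + ((1 / \<phi>\<^sup>2) *\<^sub>R \<theta>) \<bullet> x)" for \<theta> x :: "real ^ 'n"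
    using assms by (rule loc_scale_normal_kernel_eq_exp)
  show "(\<integral>\<^sup>+x. ennreal (loc_scale normal_kernel \<theta> \<phi> x) \<partial>lborel) = 1" for \<theta> :: "real ^ 'n"
    using assms by (simp add: nn_integral_loc_scale nn_integral_normal_kernel)
qed (intro continuous_intros; use assms in auto)+

section \<open>Mixtures near a target density\<close>

text \<open>
  The inequality \<open>ln t \<le> t - 1\<close> at \<open>t = F x / f0 x\<close> bounds the integrand from below by the integrable
  function \<open>f0 - F\<close>, so an integrable upper bound makes it integrable.
\<close>

lemma KL_less_if_bounded:
  fixes f0 :: "'a::euclidean_space \<Rightarrow> real"
  assumes f0: "f0 \<in> borel_measurable borel" "integrable lborel f0" "\<And>x. 0 < f0 x"
    and F: "integrable lborel F" "AE x in lborel. 0 < F x"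
    and H: "integrable lborel H" "AE x in lborel. f0 x * ln (f0 x / F x) \<le> H x"
      "(\<integral>x. H x \<partial>lborel) < \<epsilon>"
  shows "KL f0 F < ereal \<epsilon>"
proof -
  have [measurable]: "f0 \<in> borel_measurable lborel" "F \<in> borel_measurable lborel"
    using f0(1) F(1) by auto
  have low: "AE x in lborel. f0 x - F x \<le> f0 x * ln (f0 x / F x)"
    using F(2)
  proof eventually_elim
    case (elim x)
    have "ln (F x / f0 x) \<le> F x / f0 x - 1"
      using elim f0(3)[of x] by (intro ln_le_minus_one) simp
    then have "f0 x * ln (F x / f0 x) \<le> f0 x * (F x / f0 x - 1)"
      using f0(3)[of x] by (intro mult_left_mono) auto
    also have "\<dots> = F x - f0 x"
      using f0(3)[of x] by (simp add: field_simps)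
    finally show ?case
      using elim f0(3)[of x] by (simp add: ln_div algebra_simps)
  qed
  have int: "integrable lborel (\<lambda>x. f0 x * ln (f0 x / F x))"
  proof (rule Bochner_Integration.integrable_bound)
    show "integrable lborel (\<lambda>x. \<bar>H x\<bar> + \<bar>f0 x\<bar> + \<bar>F x\<bar>)"
      using f0(2) F(1) H(1) by (intro Bochner_Integration.integrable_add integrable_abs)
    show "AE x in lborel. norm (f0 x * ln (f0 x / F x)) \<le> norm (\<bar>H x\<bar> + \<bar>f0 x\<bar> + \<bar>F x\<bar>)"
      using low H(2) by eventually_elim auto
  qed measurable
  have "(\<integral>x. f0 x * ln (f0 x / F x) \<partial>lborel) \<le> (\<integral>x. H x \<partial>lborel)"
    by (rule integral_mono_AE[OF int H(1,2)])
  then show ?thesis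
    using F(2) int H(3) by (auto simp: KL_def elim: eventually_mono)
qed

context log_quadratic_kernel
begin

text \<open>
  By Tonelli's theorem the mixture integrates to one, so it is finite almost everywhere and there
  agrees with the nonnegative integral, to which the lower bounds apply.
\<close>

lemma mixture_is_density:
  assumes P: "P \<in> prob_measures S"
  shows "integrable lborel (\<lambda>x. \<integral>s. k s x \<partial>P)"
    and "AE x in lborel. ennreal (\<integral>s. k s x \<partial>P) = (\<integral>\<^sup>+s. ennreal (k s x) \<partial>P)"
proof -
  have sets_P: "sets P = sets (restrict_space borel S)" and "prob_space P" and space_P: "space P = S"
    using P sets_eq_imp_space_eq[of P "restrict_space borel S"]
    by (auto simp: prob_measures_def space_prob_algebra space_restrict_space)
  interpret prob_space P by fact
  have km[measurable]: "(\<lambda>(x, s). k s x) \<in> borel_measurable (lborel \<Otimes>\<^sub>M P)"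
    using kernel_measurable by (simp cong: measurable_cong_sets sets_pair_measure_cong add: sets_P)
  have eq: "(\<integral>s. k s x \<partial>P) = enn2real (\<integral>\<^sup>+s. ennreal (k s x) \<partial>P)" for x
  proof (rule integral_eq_nn_integral)
    show "(\<lambda>s. k s x) \<in> borel_measurable P"
      using measurable_compose[OF measurable_Pair1'[of x lborel] km] by simp
    show "AE s in P. 0 \<le> k s x"
      using space_P by (intro AE_I2) (auto intro: less_imp_le kernel_pos)
  qed
  interpret pair_sigma_finite lborel P ..
  have nm[measurable]: "(\<lambda>x. \<integral>\<^sup>+s. ennreal (k s x) \<partial>P) \<in> borel_measurable lborel"
    by measurable
  have "(\<integral>\<^sup>+x. (\<integral>\<^sup>+s. ennreal (k s x) \<partial>P) \<partial>lborel) = (\<integral>\<^sup>+s. (\<integral>\<^sup>+x. ennreal (k s x) \<partial>lborel) \<partial>P)"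
    by (rule Fubini'[symmetric]) measurable
  also have "\<dots> = (\<integral>\<^sup>+s. 1 \<partial>P)"
    using space_P by (intro nn_integral_cong) (simp add: kernel_mass)
  finally have one: "(\<integral>\<^sup>+x. (\<integral>\<^sup>+s. ennreal (k s x) \<partial>P) \<partial>lborel) = 1"
    by (simp add: emeasure_space_1)
  have "AE x in lborel. (\<integral>\<^sup>+s. ennreal (k s x) \<partial>P) \<noteq> \<infinity>"
    by (rule nn_integral_PInf_AE) (use one in auto)
  then show fin: "AE x in lborel. ennreal (\<integral>s. k s x \<partial>P) = (\<integral>\<^sup>+s. ennreal (k s x) \<partial>P)"
    by eventually_elim (simp add: eq less_top)
  show "integrable lborel (\<lambda>x. \<integral>s. k s x \<partial>P)"
  proof (rule integrableI_nonneg)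
    show "(\<lambda>x. \<integral>s. k s x \<partial>P) \<in> borel_measurable lborel"
      unfolding eq by measurable
    show "AE x in lborel. 0 \<le> (\<integral>s. k s x \<partial>P)"
      by (simp add: eq)
    have "(\<integral>\<^sup>+x. ennreal (\<integral>s. k s x \<partial>P) \<partial>lborel) = 1"
      using one nn_integral_cong_AE[OF fin] by simp
    then show "(\<integral>\<^sup>+x. ennreal (\<integral>s. k s x \<partial>P) \<partial>lborel) < \<infinity>"
      by simp
  qed
qed

end

lemma integrable_tail_small:
  fixes T :: "'a::euclidean_space \<Rightarrow> real"
  assumes T: "integrable lborel T" and "0 < \<epsilon>"
  obtains m where "1 \<le> m" "(\<integral>x. T x * indicator {x. m < norm x} x \<partial>lborel) < \<epsilon>"
proof -
  have [measurable]: "T \<in> borel_measurable borel" using T by auto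
  have "(\<lambda>n. \<integral>x. T x * indicator {x. real (Suc n) < norm x} x \<partial>lborel) \<longlonglongrightarrow> (\<integral>x. 0 \<partial>(lborel :: 'a measure))"
  proof (rule integral_dominated_convergence[OF _ _ integrable_abs[OF T]])
    show "AE x in lborel. (\<lambda>n. T x * indicator {x. real (Suc n) < norm x} x) \<longlonglongrightarrow> 0"
    proof (rule AE_I2)
      fix x :: 'a
      obtain N where N: "norm x < real N" using reals_Archimedean2 by blast
      have "eventually (\<lambda>n. T x * indicator {x. real (Suc n) < norm x} x = 0) sequentially"
        using eventually_ge_at_top[of N] by eventually_elim (use N in \<open>auto simp: indicator_def\<close>)
      then show "(\<lambda>n. T x * indicator {x. real (Suc n) < norm x} x) \<longlonglongrightarrow> 0"
        by (rule tendsto_eventually)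
    qed
  qed (auto simp: indicator_def)
  then have "eventually (\<lambda>n. (\<integral>x. T x * indicator {x. real (Suc n) < norm x} x \<partial>lborel) < \<epsilon>) sequentially"
    using \<open>0 < \<epsilon>\<close> by (intro order_tendstoD) auto
  then obtain n where "(\<integral>x. T x * indicator {x. real (Suc n) < norm x} x \<partial>lborel) < \<epsilon>"
    unfolding eventually_sequentially by blast
  then show thesis by (intro that[of "real (Suc n)"]) auto
qed

locale KL_target =
  fixes f0 :: "real ^ 'n \<Rightarrow> real"
  assumes density: "density_fun f0"
    and cont: "continuous_on UNIV f0"
    and pos: "0 < f0 x"
    and entropy: "integrable lborel (\<lambda>x. f0 x * ln (f0 x))"
    and second_moment: "integrable lborel (\<lambda>x. f0 x * (norm x)\<^sup>2)"
begin

lemma f0_measurable [measurable]: "f0 \<in> borel_measurable borel"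
  using density by (simp add: density_fun_def)

lemma f0_integrable: "integrable lborel f0"
  using density less_imp_le[OF pos] by (intro integrableI_nonneg) (auto simp: density_fun_def)

lemma f0_integral: "(\<integral>x. f0 x \<partial>lborel) = 1"
  using density less_imp_le[OF pos] by (subst integral_eq_nn_integral) (auto simp: density_fun_def)

lemma f0_quad_integrable: "integrable lborel (\<lambda>x. f0 x * quad x)"
  using f0_integrable second_moment by (simp add: quad_def distrib_left)

text \<open>
  Locations in the unit ball, which \<open>f0\<close> charges, already give a lower bound with Gaussian decay.  Its
  rate depends on the scale, but not on where the mixture is truncated; this allows the truncation
  radius to be chosen after the rate.
\<close>

lemma truncated_mixture_lower_bound:
  fixes h :: "real ^ 'n \<Rightarrow> 's::{second_countable_topology, metric_space}"
    and k :: "'s \<Rightarrow> real ^ 'n \<Rightarrow> real"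
  assumes "log_quadratic_kernel S k a b c" and h: "continuous_on UNIV h" "range h \<subseteq> S"
  obtains A where "0 \<le> A"
    "\<And>x. ennreal (exp (- A * quad x)) \<le> (\<integral>\<^sup>+\<theta>. ennreal (k (h \<theta>) x * f0 \<theta>) * indicator (cball 0 1) \<theta> \<partial>lborel)"
proof -
  interpret log_quadratic_kernel S k a b c by fact
  have "compact (h ` cball 0 1)" "h ` cball 0 1 \<subseteq> S"
    using h by (auto intro!: compact_continuous_image continuous_on_subset[OF h(1)])
  then obtain A where A: "0 \<le> A" "\<And>\<theta> x. norm \<theta> \<le> 1 \<Longrightarrow> exp (- A * quad x) \<le> k (h \<theta>) x"
    by (rule kernel_lower_bound) auto
  define v where "v = ball_inf f0 1 0 * measure lborel (ball (0 :: real ^ 'n) 1)"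
  have bp: "0 < ball_inf f0 1 0"
    by (rule ball_inf_pos[OF cont pos]) simp
  have v: "0 < v"
    using bp content_ball_pos[of 1 "0 :: real ^ 'n"] by (simp add: v_def)
  show thesis
  proof (rule that[of "A + \<bar>ln v\<bar>"])
    show "0 \<le> A + \<bar>ln v\<bar>" using A by simp
    fix x :: "real ^ 'n"
    have "- (A + \<bar>ln v\<bar>) * quad x \<le> - A * quad x + ln v"
      using mult_left_mono[OF quad_ge_1, of "\<bar>ln v\<bar>" x] by (simp add: algebra_simps)
    then have "exp (- (A + \<bar>ln v\<bar>) * quad x) \<le> exp (- A * quad x) * v"
      using v by (metis exp_add exp_le_cancel_iff exp_ln)
    then have "ennreal (exp (- (A + \<bar>ln v\<bar>) * quad x)) \<le> ennreal (exp (- A * quad x) * v)"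
      by (rule ennreal_leI)
    also have "\<dots> = (\<integral>\<^sup>+\<theta>. ennreal (exp (- A * quad x) * ball_inf f0 1 0) * indicator (ball 0 1) \<theta> \<partial>(lborel :: (real ^ 'n) measure))"
      using bp emeasure_lborel_ball_finite[of "0 :: real ^ 'n" 1]
      by (subst nn_integral_cmult_indicator)
         (simp_all add: v_def emeasure_eq_ennreal_measure less_top ennreal_mult'[symmetric] mult.assoc)
    also have "\<dots> \<le> (\<integral>\<^sup>+\<theta>. ennreal (k (h \<theta>) x * f0 \<theta>) * indicator (cball 0 1) \<theta> \<partial>lborel)"
    proof (rule nn_integral_mono)
      fix \<theta> :: "real ^ 'n"
      show "ennreal (exp (- A * quad x) * ball_inf f0 1 0) * indicator (ball 0 1) \<theta>
          \<le> ennreal (k (h \<theta>) x * f0 \<theta>) * indicator (cball 0 1) \<theta>"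
      proof (cases "norm \<theta> < 1")
        case True
        then have "exp (- A * quad x) * ball_inf f0 1 0 \<le> k (h \<theta>) x * f0 \<theta>"
          using A(2)[of \<theta> x] ball_inf_le[OF cont pos, of \<theta> 0 1] bp
          by (intro mult_mono) (auto intro: order_trans[OF exp_ge_zero])
        then show ?thesis using True by (simp add: ennreal_leI)
      qed simp
    qed
    finally show "ennreal (exp (- (A + \<bar>ln v\<bar>) * quad x))
        \<le> (\<integral>\<^sup>+\<theta>. ennreal (k (h \<theta>) x * f0 \<theta>) * indicator (cball 0 1) \<theta> \<partial>lborel)" .
  qed
qed

text \<open>
  The embedding \<open>h\<close> sends a location to the corresponding parameter at the fixed scale \<open>\<phi>\<close>, so that
  the centre \<open>P0\<close> of the neighbourhood is the image of the distribution with density \<open>f0\<close>.  The bound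
  \<open>4 * \<epsilon>\<close> adds up the costs of passing from \<open>P0\<close> to \<open>P\<close>, of the kernel mass outside the
  ball of radius \<open>r\<close>, of replacing \<open>f0\<close> by its infimum over this ball, and of the tail.
\<close>

lemma KL_small_on_weak_neighbourhood:
  fixes h :: "real ^ 'n \<Rightarrow> 's::{second_countable_topology, metric_space}"
    and k :: "'s \<Rightarrow> real ^ 'n \<Rightarrow> real"
  assumes kern: "log_quadratic_kernel S k a b c" and h: "continuous_on UNIV h" "range h \<subseteq> S"
    and kh: "\<And>(\<theta> :: real ^ 'n) x. k (h \<theta>) x = loc_scale normal_kernel \<theta> \<phi> x"
    and r: "0 < r" "integrable lborel (\<lambda>x. f0 x * ln (f0 x / ball_inf f0 r x))"
      "(\<integral>x. f0 x * ln (f0 x / ball_inf f0 r x) \<partial>lborel) < \<epsilon>"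
    and conc: "\<And>x :: real ^ 'n. ennreal (exp (- \<epsilon>)) \<le>
      (\<integral>\<^sup>+\<theta>. ennreal (loc_scale normal_kernel \<theta> \<phi> x) * indicator {\<theta>. norm (\<theta> - x) < r} \<theta> \<partial>lborel)"
    and "0 < \<epsilon>"
  obtains U where "openin (weak_topology S) U" "U \<noteq> {}"
    "\<And>P. P \<in> U \<Longrightarrow> KL f0 (\<lambda>x. \<integral>s. k s x \<partial>P) < ereal (4 * \<epsilon>)"
proof -
  interpret log_quadratic_kernel S k a b c by fact
  have hm[measurable]: "h \<in> measurable borel (restrict_space borel S)"
    using h by (intro measurable_restrict_space2 borel_measurable_continuous_onI) auto
  have km[measurable]: "(\<lambda>s. k s x) \<in> borel_measurable (restrict_space borel S)" for x
    using measurable_compose[OF measurable_Pair1'[of x borel] kernel_measurable] by simp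
  define D where "D = density lborel (\<lambda>\<theta>. ennreal (f0 \<theta>))"
  define P0 where "P0 = distr D (restrict_space borel S) h"
  have hD[measurable]: "h \<in> measurable D (restrict_space borel S)"
    using hm by (simp add: D_def cong: measurable_cong_sets)
  have "prob_space D"
    using density by (intro prob_spaceI) (simp add: D_def emeasure_density density_fun_def)
  then have P0: "P0 \<in> prob_measures S"
    unfolding prob_measures_def P0_def space_prob_algebra
    using prob_space.prob_space_distr[OF _ hD] by auto
  obtain A where A: "0 \<le> A"
    "\<And>x. ennreal (exp (- A * quad x)) \<le> (\<integral>\<^sup>+\<theta>. ennreal (k (h \<theta>) x * f0 \<theta>) * indicator (cball 0 1) \<theta> \<partial>lborel)"
    using truncated_mixture_lower_bound[OF kern h] by blast
  define T where "T x = f0 x * (\<bar>ln (f0 x)\<bar> + A * quad x)" for x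
  have T_int: "integrable lborel T"
  proof -
    have "T = (\<lambda>x. \<bar>f0 x * ln (f0 x)\<bar> + A * (f0 x * quad x))"
      using less_imp_le[OF pos] by (auto simp: T_def fun_eq_iff abs_mult algebra_simps)
    then show ?thesis
      using entropy f0_quad_integrable by auto
  qed
  obtain m where m: "1 \<le> m" "(\<integral>x. T x * indicator {x. m < norm x} x \<partial>lborel) < \<epsilon>"
    using integrable_tail_small[OF T_int \<open>0 < \<epsilon>\<close>] by blast
  \<comment> \<open>The radius exceeds \<open>m\<close> by \<open>r\<close> so that the ball about each
    \<open>x\<close> with \<open>norm x \<le> m\<close> is not truncated.\<close>
  define C where "C = h ` cball 0 (m + r)"
  have C: "compact C" "C \<subseteq> S"
    using h by (auto simp: C_def intro!: compact_continuous_image continuous_on_subset[OF h(1)])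
  define Q where "Q = (\<integral>x. f0 x * quad x \<partial>lborel)"
  have Q: "0 \<le> Q"
    unfolding Q_def using pos quad_ge_1
    by (intro Bochner_Integration.integral_nonneg mult_nonneg_nonneg)
       (auto intro: less_imp_le order_trans[OF zero_le_one])
  define \<rho> where "\<rho> = \<epsilon> / (1 + Q)"
  have \<rho>: "0 < \<rho>" "\<rho> * Q < \<epsilon>"
    using Q \<open>0 < \<epsilon>\<close> by (auto simp: \<rho>_def field_simps)
  obtain U where U: "openin (weak_topology S) U" "P0 \<in> U"
    "\<And>P x. P \<in> U \<Longrightarrow>
       ennreal (exp (- \<rho> * quad x)) * (\<integral>\<^sup>+s. ennreal (k s x) * indicator C s \<partial>P0) \<le> (\<integral>\<^sup>+s. ennreal (k s x) \<partial>P)"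
    using weak_neighbourhood_kernel_bound[OF P0 C \<rho>(1)] by blast
  have [measurable]: "C \<in> sets (restrict_space borel S)"
    using C by (auto simp: sets_restrict_space intro!: image_eqI[of _ _ C] borel_closed compact_imp_closed)
  define G where "G x = (\<integral>\<^sup>+s. ennreal (k s x) * indicator C s \<partial>P0)" for x
  have G_eq: "G x = (\<integral>\<^sup>+\<theta>. ennreal (f0 \<theta>) * (ennreal (k (h \<theta>) x) * indicator C (h \<theta>)) \<partial>lborel)" for x
    unfolding G_def P0_def by (subst nn_integral_distr) (auto simp: D_def nn_integral_density)
  have inC: "h \<theta> \<in> C" if "norm \<theta> \<le> m + r" for \<theta>
    using that by (auto simp: C_def)
  have k0: "0 \<le> k (h \<theta>) x" for \<theta> x
    using kernel_pos[of "h \<theta>" x] h(2) by (auto simp: range_subsetD less_imp_le)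
  have G1: "ennreal (exp (- A * quad x)) \<le> G x" for x
  proof -
    have "(\<integral>\<^sup>+\<theta>. ennreal (k (h \<theta>) x * f0 \<theta>) * indicator (cball 0 1) \<theta> \<partial>lborel) \<le> G x"
      unfolding G_eq using m(1) r(1) k0 less_imp_le[OF pos] inC
      by (intro nn_integral_mono) (auto simp: indicator_def ennreal_mult'[symmetric] mult_ac)
    then show ?thesis using A(2)[of x] by (rule order_trans[rotated])
  qed
  have bp: "0 < ball_inf f0 r x" for x
    by (rule ball_inf_pos[OF cont pos r(1)])
  have G2: "ennreal (exp (- \<epsilon>) * ball_inf f0 r x) \<le> G x" if "norm x \<le> m" for x
  proof -
    define g where "g \<theta> = ennreal (loc_scale normal_kernel \<theta> \<phi> x) * indicator {\<theta>. norm (\<theta> - x) < r} \<theta>" for \<theta>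
    have [measurable]: "g \<in> borel_measurable borel"
      unfolding g_def loc_scale_def by measurable
    have "ennreal (exp (- \<epsilon>) * ball_inf f0 r x) = ennreal (ball_inf f0 r x) * ennreal (exp (- \<epsilon>))"
      using bp[of x] by (simp add: ennreal_mult' mult.commute)
    also have "\<dots> \<le> ennreal (ball_inf f0 r x) * (\<integral>\<^sup>+\<theta>. g \<theta> \<partial>lborel)"
      using conc[of x] unfolding g_def by (intro mult_left_mono) auto
    also have "\<dots> = (\<integral>\<^sup>+\<theta>. ennreal (ball_inf f0 r x) * g \<theta> \<partial>lborel)"
      by (simp add: nn_integral_cmult)
    also have "\<dots> \<le> G x"
      unfolding G_eq
    proof (rule nn_integral_mono)
      fix \<theta> :: "real ^ 'n"
      show "ennreal (ball_inf f0 r x) * g \<theta> \<le> ennreal (f0 \<theta>) * (ennreal (k (h \<theta>) x) * indicator C (h \<theta>))"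
      proof (cases "norm (\<theta> - x) < r")
        case True
        have "norm \<theta> \<le> m + r"
          using norm_triangle_ineq2[of \<theta> x] True that by simp
        then show ?thesis
          using True ball_inf_le[OF cont pos True] inC[of \<theta>]
          by (simp add: g_def kh mult_right_mono ennreal_leI)
      qed (simp add: g_def)
    qed
    finally show ?thesis .
  qed
  define L where "L x = (if norm x \<le> m then exp (- \<epsilon>) * ball_inf f0 r x else exp (- A * quad x))" for x
  have L: "0 < L x" "ennreal (L x) \<le> G x" for x
    using G1 G2 bp by (auto simp: L_def)
  \<comment> \<open>The second and third terms matter for \<open>norm x \<le> m\<close> only; being
    nonnegative, they may stay elsewhere.\<close>
  define H where "H x = \<rho> * (f0 x * quad x) + \<epsilon> * f0 x + f0 x * ln (f0 x / ball_inf f0 r x)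
      + T x * indicator {x. m < norm x} x" for x
  have T_tail_int: "integrable lborel (\<lambda>x. T x * indicator {x. m < norm x} x)"
    using T_int by (rule integrable_real_mult_indicator[rotated]) simp
  have H_int: "integrable lborel H"
    unfolding H_def
    by (intro Bochner_Integration.integrable_add integrable_mult_right f0_quad_integrable
        f0_integrable r(2) T_tail_int)
  have H_small: "(\<integral>x. H x \<partial>lborel) < 4 * \<epsilon>"
  proof -
    have "(\<integral>x. H x \<partial>lborel) = \<rho> * Q + \<epsilon> * 1 + (\<integral>x. f0 x * ln (f0 x / ball_inf f0 r x) \<partial>lborel)
        + (\<integral>x. T x * indicator {x. m < norm x} x \<partial>lborel)"
      unfolding H_def Q_def f0_integral[symmetric]
      using f0_quad_integrable f0_integrable r(2) T_tail_int by simp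
    then show ?thesis using \<rho>(2) r(3) m(2) by linarith
  qed
  have log_L: "f0 x * (\<rho> * quad x + ln (f0 x) - ln (L x)) \<le> H x" for x
  proof -
    have n1: "0 \<le> f0 x * ln (f0 x / ball_inf f0 r x)"
      using ball_inf_le[OF cont pos, of x x r] r(1) pos[of x] bp[of x] by simp
    show ?thesis
    proof (cases "norm x \<le> m")
      case True
      have ln_L: "ln (L x) = - \<epsilon> + ln (ball_inf f0 r x)"
        using True bp[of x] by (simp add: L_def ln_mult)
      show ?thesis
        using True bp[of x] pos[of x] by (simp add: ln_L H_def ln_div algebra_simps)
    next
      case False
      have "f0 x * (ln (f0 x) + A * quad x) \<le> T x"
        unfolding T_def using pos[of x] by (intro mult_left_mono) auto
      moreover have "0 \<le> \<epsilon> * f0 x" using pos[of x] \<open>0 < \<epsilon>\<close> by simp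
      ultimately show ?thesis
        using False n1 by (simp add: H_def L_def algebra_simps)
    qed
  qed
  show thesis
  proof (rule that[OF U(1)])
    show "U \<noteq> {}" using U(2) by auto
    fix P assume PU: "P \<in> U"
    have P: "P \<in> prob_measures S"
      using openin_subset[OF U(1)] PU by (auto simp: topspace_weak_topology)
    have F_low: "AE x in lborel. exp (- \<rho> * quad x) * L x \<le> (\<integral>s. k s x \<partial>P)"
      using mixture_is_density(2)[OF P]
    proof eventually_elim
      case (elim x)
      have "ennreal (exp (- \<rho> * quad x) * L x) = ennreal (exp (- \<rho> * quad x)) * ennreal (L x)"
        by (simp add: ennreal_mult')
      also have "\<dots> \<le> ennreal (exp (- \<rho> * quad x)) * G x"
        using L(2) by (intro mult_left_mono) auto
      also have "\<dots> \<le> ennreal (\<integral>s. k s x \<partial>P)"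
        using U(3)[OF PU] elim by (simp add: G_def)
      finally have *: "ennreal (exp (- \<rho> * quad x) * L x) \<le> ennreal (\<integral>s. k s x \<partial>P)" .
      have "0 < exp (- \<rho> * quad x) * L x" using L(1)[of x] by simp
      with * show ?case
        by (metis ennreal_le_iff2 linorder_not_le)
    qed
    have low_pos: "0 < exp (- \<rho> * quad x) * L x" for x
      using L(1)[of x] by simp
    show "KL f0 (\<lambda>x. \<integral>s. k s x \<partial>P) < ereal (4 * \<epsilon>)"
    proof (rule KL_less_if_bounded[OF f0_measurable f0_integrable pos _ _ H_int _ H_small])
      show "integrable lborel (\<lambda>x. \<integral>s. k s x \<partial>P)"
        by (rule mixture_is_density(1)[OF P])
      show "AE x in lborel. 0 < (\<integral>s. k s x \<partial>P)"
        using F_low by eventually_elim (use low_pos in \<open>auto intro: less_le_trans\<close>)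
      show "AE x in lborel. f0 x * ln (f0 x / (\<integral>s. k s x \<partial>P)) \<le> H x"
        using F_low
      proof eventually_elim
        case (elim x)
        have F: "0 < (\<integral>s. k s x \<partial>P)" using elim low_pos[of x] by linarith
        have "ln (exp (- \<rho> * quad x) * L x) \<le> ln (\<integral>s. k s x \<partial>P)"
          using elim low_pos[of x] F by simp
        then have "ln (f0 x / (\<integral>s. k s x \<partial>P)) \<le> \<rho> * quad x + ln (f0 x) - ln (L x)"
          using L(1)[of x] F pos[of x] by (simp add: ln_div ln_mult)
        then have "f0 x * ln (f0 x / (\<integral>s. k s x \<partial>P)) \<le> f0 x * (\<rho> * quad x + ln (f0 x) - ln (L x))"
          using pos[of x] by (intro mult_left_mono) auto
        then show ?case using log_L[of x] by linarith
      qed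
    qed
  qed
qed

end

section \<open>Positivity of the prior mass\<close>

text \<open>
  Nonnegativity of \<open>g\<close> makes the Bochner integral, with its value 0 in case of divergence, the real
  part of a nonnegative integral, which is measurable in the measure and the parameter jointly.
\<close>

lemma measurable_integral_prob_algebra:
  fixes g :: "'y \<Rightarrow> 's \<Rightarrow> real"
  assumes L: "L \<in> measurable N (prob_algebra R)"
    and g[measurable]: "(\<lambda>(y, s). g y s) \<in> borel_measurable (N \<Otimes>\<^sub>M R)"
    and nonneg: "\<And>y s. y \<in> space N \<Longrightarrow> s \<in> space R \<Longrightarrow> 0 \<le> g y s"
  shows "(\<lambda>y. \<integral>s. g y s \<partial>L y) \<in> borel_measurable N"
proof -
  have "(\<lambda>y. enn2real (\<integral>\<^sup>+s. ennreal (g y s) \<partial>L y)) \<in> borel_measurable N"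
    by (rule borel_measurable_enn2real,
        rule nn_integral_measurable_subprob_algebra2[OF _ measurable_prob_algebraD[OF L]]) measurable
  also have "?this \<longleftrightarrow> ?thesis"
  proof (rule measurable_cong)
    fix y assume y: "y \<in> space N"
    then have sets: "sets (L y) = sets R"
      using measurable_space[OF L y] by (simp add: space_prob_algebra)
    have "g y \<in> borel_measurable R"
      using measurable_compose[OF measurable_Pair1'[OF y] g] by simp
    then show "enn2real (\<integral>\<^sup>+s. ennreal (g y s) \<partial>L y) = (\<integral>s. g y s \<partial>L y)"
      using nonneg[OF y] sets_eq_imp_space_eq[OF sets]
      by (intro integral_eq_nn_integral[symmetric]) (auto simp: sets cong: measurable_cong_sets)
  qed
  finally show ?thesis .
qed

text \<open>
  In the law of the mixture an event has positive mass only if its preimage is measurable, so this is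
  needed in addition to the neighbourhoods.  The almost-everywhere condition in \<open>KL\<close> is written as
  the vanishing of an integral that depends measurably on \<open>p\<close>.
\<close>

lemma KL_sublevel_measurable:
  fixes f0 :: "'a::euclidean_space \<Rightarrow> real"
  assumes [measurable]: "f0 \<in> borel_measurable borel" "(\<lambda>(p, x). F p x) \<in> borel_measurable (N \<Otimes>\<^sub>M lborel)"
  shows "{p \<in> space N. KL f0 (F p) < ereal \<epsilon>} \<in> sets N"
proof -
  define u :: "'b \<Rightarrow> 'a \<Rightarrow> ennreal" where "u p x = (if 0 < f0 x \<and> \<not> 0 < F p x then 1 else 0)" for p x
  have um[measurable]: "(\<lambda>(p, x). u p x) \<in> borel_measurable (N \<Otimes>\<^sub>M lborel)"
    unfolding u_def by measurable
  have AE: "(AE x in lborel. 0 < f0 x \<longrightarrow> 0 < F p x) \<longleftrightarrow> (\<integral>\<^sup>+x. u p x \<partial>lborel) = 0" if p: "p \<in> space N" for p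
  proof -
    have "u p \<in> borel_measurable lborel"
      using measurable_compose[OF measurable_Pair1'[OF p] um] by simp
    then have "(\<integral>\<^sup>+x. u p x \<partial>lborel) = 0 \<longleftrightarrow> (AE x in lborel. u p x = 0)"
      by (rule nn_integral_0_iff_AE)
    also have "\<dots> \<longleftrightarrow> (AE x in lborel. 0 < f0 x \<longrightarrow> 0 < F p x)"
      by (simp add: u_def)
    finally show ?thesis by simp
  qed
  have "{p \<in> space N. KL f0 (F p) < ereal \<epsilon>} =
      {p \<in> space N. (\<integral>\<^sup>+x. u p x \<partial>lborel) = 0 \<and> integrable lborel (\<lambda>x. f0 x * ln (f0 x / F p x)) \<and>
        (\<integral>x. f0 x * ln (f0 x / F p x) \<partial>lborel) < \<epsilon>}"
    using AE by (auto simp: KL_def split: if_splits)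
  also have "\<dots> \<in> sets N"
    by measurable
  finally show ?thesis .
qed

lemma second_moment_of_higher_moment:
  fixes f0 :: "'a::euclidean_space \<Rightarrow> real"
  assumes f0: "integrable lborel f0" "\<And>x. 0 \<le> f0 x" and "0 < \<eta>"
    and m: "integrable lborel (\<lambda>x. norm x powr (2 * (1 + \<eta>)) * f0 x)"
  shows "integrable lborel (\<lambda>x. f0 x * (norm x)\<^sup>2)"
proof (rule Bochner_Integration.integrable_bound)
  show "integrable lborel (\<lambda>x. f0 x + norm x powr (2 * (1 + \<eta>)) * f0 x)"
    using f0(1) m by (rule Bochner_Integration.integrable_add)
  have [measurable]: "f0 \<in> borel_measurable lborel" using f0(1) by auto
  show "(\<lambda>x. f0 x * (norm x)\<^sup>2) \<in> borel_measurable lborel" by measurable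
  show "AE x in lborel. norm (f0 x * (norm x)\<^sup>2) \<le> norm (f0 x + norm x powr (2 * (1 + \<eta>)) * f0 x)"
  proof (rule AE_I2)
    fix x :: 'a
    have "(norm x)\<^sup>2 \<le> 1 + norm x powr (2 * (1 + \<eta>))"
    proof (cases "norm x \<le> 1")
      case True
      then have "(norm x)\<^sup>2 \<le> 1" by (simp add: power_le_one)
      then show ?thesis using powr_ge_zero[of "norm x" "2 * (1 + \<eta>)"] by linarith
    next
      case False
      then have "(norm x)\<^sup>2 = norm x powr 2" by (simp add: powr_numeral)
      also have "\<dots> \<le> norm x powr (2 * (1 + \<eta>))"
        using False \<open>0 < \<eta>\<close> by (intro powr_mono) auto
      finally show ?thesis by simp
    qed
    then have "f0 x * (norm x)\<^sup>2 \<le> f0 x * (1 + norm x powr (2 * (1 + \<eta>)))"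
      using f0(2)[of x] by (rule mult_left_mono)
    then show "norm (f0 x * (norm x)\<^sup>2) \<le> norm (f0 x + norm x powr (2 * (1 + \<eta>)) * f0 x)"
      using f0(2)[of x] by (simp add: algebra_simps abs_mult)
  qed
qed

lemma mixing_priorsD:
  assumes "\<Lambda> \<in> mixing_priors S"
  shows "sets \<Lambda> = sets (prob_algebra (restrict_space borel S))" "space \<Lambda> = prob_measures S" "prob_space \<Lambda>"
  using assms sets_eq_imp_space_eq[of \<Lambda> "prob_algebra (restrict_space borel S)"]
  by (auto simp: mixing_priors_def prob_measures_def space_prob_algebra[of "prob_algebra _"])

text \<open>
  A set that is not measurable is given measure 0 by convention; membership of its points in the weak
  support thus contains the measurability of \<open>U\<close>, and only the event \<open>E\<close> needs a separate proof.
\<close>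

lemma full_weak_support_charges_open:
  assumes supp: "weak_support S \<Lambda> = prob_measures S" and U: "openin (weak_topology S) U" "U \<noteq> {}"
    and "U \<subseteq> E" "E \<in> sets \<Lambda>"
  shows "0 < emeasure \<Lambda> E"
proof -
  obtain P where P: "P \<in> U" using U(2) by auto
  then have "P \<in> weak_support S \<Lambda>"
    unfolding supp using openin_subset[OF U(1)] by (auto simp: topspace_weak_topology)
  then have "0 < emeasure \<Lambda> U"
    using U(1) P by (auto simp: weak_support_def)
  also have "\<dots> \<le> emeasure \<Lambda> E"
    using assms(4,5) by (rule emeasure_mono)
  finally show ?thesis .
qed

lemma loc_scale_nonneg: "(\<And>x. 0 \<le> K x) \<Longrightarrow> 0 < \<phi> \<Longrightarrow> 0 \<le> loc_scale K \<theta> \<phi> x"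
  by (simp add: loc_scale_def)

lemma type_I_KL_positive:
  fixes f0 :: "real ^ 'n \<Rightarrow> real"
  assumes \<Lambda>: "\<Lambda> \<in> mixing_priors (UNIV \<times> {0<..})"
      "weak_support (UNIV \<times> {0<..}) \<Lambda> = prob_measures (UNIV \<times> {0<..})"
    and f0: "f0 \<in> borel_measurable borel"
    and U: "openin (weak_topology (UNIV \<times> {0<..})) U" "U \<noteq> {}"
      "\<And>P. P \<in> U \<Longrightarrow> KL f0 (mixture_I normal_kernel P) < ereal \<epsilon>"
  shows "0 < emeasure (type_I_prior normal_kernel \<Lambda>) {f. KL f0 f < ereal \<epsilon>}"
proof -
  define S :: "((real ^ 'n) \<times> real) set" where "S = UNIV \<times> {0<..}"
  note \<Lambda>' = mixing_priorsD[OF \<Lambda>(1), folded S_def]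
  interpret log_quadratic_kernel S "\<lambda>s. loc_scale normal_kernel (fst s) (snd s)"
     "\<lambda>s. normal_log_const (fst s) (snd s)"
     "\<lambda>s. - 1 / (2 * (snd s)\<^sup>2)" "\<lambda>s. (1 / (snd s)\<^sup>2) *\<^sub>R (fst s :: real ^ 'n)"
    unfolding S_def by (rule log_quadratic_kernel_type_I)
  have km: "(\<lambda>(x, s). loc_scale normal_kernel (fst s) (snd s) x) \<in> borel_measurable (lborel \<Otimes>\<^sub>M restrict_space borel S)"
    using kernel_measurable by (simp cong: measurable_cong_sets sets_pair_measure_cong)
  have "(\<lambda>y. \<integral>s. loc_scale normal_kernel (fst s) (snd s) (snd y) \<partial>(fst y)) \<in>
      borel_measurable (prob_algebra (restrict_space borel S) \<Otimes>\<^sub>M (lborel :: (real ^ 'n) measure))"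
  proof (rule measurable_integral_prob_algebra)
    show "(\<lambda>(y, s). loc_scale normal_kernel (fst s) (snd s) (snd y)) \<in>
        borel_measurable ((prob_algebra (restrict_space borel S) \<Otimes>\<^sub>M lborel) \<Otimes>\<^sub>M restrict_space borel S)"
    proof -
      have "(\<lambda>(y, s). (snd y, s)) \<in> ((prob_algebra (restrict_space borel S) \<Otimes>\<^sub>M lborel) \<Otimes>\<^sub>M restrict_space borel S)
          \<rightarrow>\<^sub>M (lborel :: (real ^ 'n) measure) \<Otimes>\<^sub>M restrict_space borel S"
        by measurable
      from measurable_compose[OF this km] show ?thesis by (simp add: split_beta')
    qed
    show "0 \<le> loc_scale normal_kernel (fst s) (snd s) (snd y)" if "s \<in> space (restrict_space borel S)"
      for s and y :: "_ \<times> (real ^ 'n)"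
      using that by (auto simp: space_restrict_space S_def intro!: loc_scale_nonneg less_imp_le[OF normal_kernel_pos])
  qed measurable
  then have "(\<lambda>(P, x). mixture_I normal_kernel P x) \<in> borel_measurable (\<Lambda> \<Otimes>\<^sub>M lborel)"
    by (simp add: mixture_I_def split_beta' \<Lambda>'(1) cong: measurable_cong_sets sets_pair_measure_cong)
  then have E: "{P \<in> space \<Lambda>. KL f0 (mixture_I normal_kernel P) < ereal \<epsilon>} \<in> sets \<Lambda>"
    using f0 by (rule KL_sublevel_measurable[rotated])
  have vimage: "mixture_I normal_kernel -` {f. KL f0 f < ereal \<epsilon>} \<inter> space \<Lambda>
      = {P \<in> space \<Lambda>. KL f0 (mixture_I normal_kernel P) < ereal \<epsilon>}"
    by auto
  have "0 < emeasure \<Lambda> {P \<in> space \<Lambda>. KL f0 (mixture_I normal_kernel P) < ereal \<epsilon>}"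
    using openin_subset[OF U(1)] U(3) \<Lambda>'(2)
    by (intro full_weak_support_charges_open[OF \<Lambda>(2) U(1,2) _ E]) (auto simp: S_def topspace_weak_topology)
  then show ?thesis
    unfolding type_I_prior_def using E by (subst emeasure_law) (simp_all only: sets_law vimage mem_Collect_eq)
qed

text \<open>
  The neighbourhood may depend on the scale: the product measure of the event is the integral over
  \<open>\<phi>\<close> of the masses of its slices, and these are positive for all \<open>\<phi>\<close> in a set that \<open>\<mu>\<close> charges.
\<close>

lemma type_II_KL_positive:
  fixes f0 :: "real ^ 'n \<Rightarrow> real"
  assumes \<Lambda>: "\<Lambda> \<in> mixing_priors UNIV" "weak_support UNIV \<Lambda> = prob_measures UNIV"
    and \<mu>: "\<mu> \<in> prob_measures {0<..}" "emeasure \<mu> {0<..<\<phi>0} > 0"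
    and f0: "f0 \<in> borel_measurable borel"
    and U: "\<And>\<phi>. 0 < \<phi> \<Longrightarrow> \<phi> < \<phi>0 \<Longrightarrow> \<exists>U. openin (weak_topology UNIV) U \<and> U \<noteq> {} \<and>
      (\<forall>P\<in>U. KL f0 (mixture_II normal_kernel P \<phi>) < ereal \<epsilon>)"
  shows "0 < emeasure (type_II_prior normal_kernel \<Lambda> \<mu>) {f. KL f0 f < ereal \<epsilon>}"
proof -
  note \<Lambda>' = mixing_priorsD[OF \<Lambda>(1)]
  have \<mu>': "sets \<mu> = sets (restrict_space borel {0<..})" "prob_space \<mu>" "space \<mu> = {0<..}"
    using \<mu>(1) sets_eq_imp_space_eq[of \<mu> "restrict_space borel {0<..}"]
    by (auto simp: prob_measures_def space_prob_algebra space_restrict_space)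
  interpret \<Lambda>: prob_space \<Lambda> by fact
  interpret \<mu>: prob_space \<mu> by fact
  interpret pair_sigma_finite \<Lambda> \<mu> ..
  let ?N = "(prob_algebra (restrict_space borel UNIV) \<Otimes>\<^sub>M restrict_space borel {0::real<..}) \<Otimes>\<^sub>M (lborel :: (real ^ 'n) measure)"
  have "(\<lambda>y. \<integral>\<theta>. loc_scale normal_kernel \<theta> (snd (fst y)) (snd y) \<partial>(fst (fst y))) \<in> borel_measurable ?N"
  proof (rule measurable_integral_prob_algebra)
    have [measurable]: "(\<lambda>\<theta> :: real ^ 'n. \<theta>) \<in> measurable (restrict_space borel UNIV) borel"
      "(\<lambda>\<phi> :: real. \<phi>) \<in> measurable (restrict_space borel {0<..}) borel"
      by (auto intro: measurable_restrict_space1)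
    have [measurable]: "(\<lambda>y. snd (fst (fst y))) \<in> borel_measurable (?N \<Otimes>\<^sub>M restrict_space borel UNIV)"
      by (rule measurable_compose[where g="\<lambda>\<phi>. \<phi>" and N="restrict_space borel {0<..}"]) measurable
    have [measurable]: "snd \<in> borel_measurable (?N \<Otimes>\<^sub>M restrict_space borel (UNIV :: (real ^ 'n) set))"
      by (rule measurable_compose[where g="\<lambda>\<theta>. \<theta>" and N="restrict_space borel UNIV"]) measurable
    show "(\<lambda>(y, \<theta>). loc_scale normal_kernel \<theta> (snd (fst y)) (snd y)) \<in> borel_measurable (?N \<Otimes>\<^sub>M restrict_space borel UNIV)"
      unfolding loc_scale_def split_beta' by measurable
    show "0 \<le> loc_scale normal_kernel \<theta> (snd (fst y)) (snd y)" if "y \<in> space ?N" for \<theta> y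
      using that by (auto simp: space_pair_measure space_restrict_space
          intro!: loc_scale_nonneg less_imp_le[OF normal_kernel_pos])
  qed measurable
  then have "(\<lambda>(p, x). (case p of (P, \<phi>) \<Rightarrow> mixture_II normal_kernel P \<phi>) x) \<in> borel_measurable ((\<Lambda> \<Otimes>\<^sub>M \<mu>) \<Otimes>\<^sub>M lborel)"
    by (simp add: mixture_II_def split_beta' \<Lambda>'(1) \<mu>'(1) cong: measurable_cong_sets sets_pair_measure_cong)
  then have E: "{p \<in> space (\<Lambda> \<Otimes>\<^sub>M \<mu>). KL f0 (case p of (P, \<phi>) \<Rightarrow> mixture_II normal_kernel P \<phi>) < ereal \<epsilon>} \<in> sets (\<Lambda> \<Otimes>\<^sub>M \<mu>)"
    (is "?E \<in> _")
    using f0 by (rule KL_sublevel_measurable[rotated])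
  have vimage: "(\<lambda>(P, \<phi>). mixture_II normal_kernel P \<phi>) -` {f. KL f0 f < ereal \<epsilon>} \<inter> space (\<Lambda> \<Otimes>\<^sub>M \<mu>) = ?E"
    by auto
  have slice: "0 < emeasure \<Lambda> ((\<lambda>P. (P, \<phi>)) -` ?E)" if \<phi>: "\<phi> \<in> {0<..<\<phi>0}" for \<phi>
  proof -
    obtain U where "openin (weak_topology UNIV) U" "U \<noteq> {}"
      "\<forall>P\<in>U. KL f0 (mixture_II normal_kernel P \<phi>) < ereal \<epsilon>"
      using U[of \<phi>] \<phi> by auto
    then show ?thesis
      using \<phi> openin_subset[of "weak_topology UNIV" U] sets_Pair2[OF E, of \<phi>]
      by (intro full_weak_support_charges_open[OF \<Lambda>(2)])
         (auto simp: space_pair_measure \<Lambda>'(2) \<mu>'(3) topspace_weak_topology)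
  qed
  have "emeasure (\<Lambda> \<Otimes>\<^sub>M \<mu>) ?E \<noteq> 0"
  proof
    assume "emeasure (\<Lambda> \<Otimes>\<^sub>M \<mu>) ?E = 0"
    then have "AE \<phi> in \<mu>. emeasure \<Lambda> ((\<lambda>P. (P, \<phi>)) -` ?E) = 0"
      using measurable_emeasure_Pair2[OF E]
      by (simp add: emeasure_pair_measure_alt2[OF E] nn_integral_0_iff_AE)
    then have "AE \<phi> in \<mu>. \<phi> \<notin> {0<..<\<phi>0}"
      by eventually_elim (use slice in fastforce)
    moreover have "{0<..<\<phi>0} \<in> sets \<mu>"
      by (auto simp: \<mu>'(1) sets_restrict_space intro!: image_eqI[of _ _ "{0<..<\<phi>0}"])
    ultimately have "emeasure \<mu> {0<..<\<phi>0} = 0"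
      using AE_iff_measurable[of "{0<..<\<phi>0}" \<mu> "\<lambda>\<phi>. \<phi> \<notin> {0<..<\<phi>0}"] by (auto simp: \<mu>'(3) greaterThanLessThan_eq Int_def)
    with \<mu>(2) show False by simp
  qed
  then show ?thesis
    unfolding type_II_prior_def using E by (subst emeasure_law)
    (simp_all only: sets_law vimage mem_Collect_eq zero_less_iff_neq_zero not_False_eq_True)
qed

theorem theorem5:
  fixes f0 :: "real ^ 'n \<Rightarrow> real"
    and Pstar :: "(real ^ 'n \<Rightarrow> real) measure"
    and M \<delta> \<eta> :: real
  assumes prior:
    "(\<exists>\<Lambda> \<in> mixing_priors (UNIV \<times> {0<..}).
        weak_support (UNIV \<times> {0<..}) \<Lambda> = prob_measures (UNIV \<times> {0<..}) \<and>
        Pstar = type_I_prior normal_kernel \<Lambda>)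
   \<or> (\<exists>\<Lambda> \<in> mixing_priors UNIV. \<exists>\<mu> \<in> prob_measures {0<..}.
        weak_support UNIV \<Lambda> = prob_measures UNIV \<and>
        (\<forall>r>0. emeasure \<mu> {0<..<r} > 0) \<and>
        Pstar = type_II_prior normal_kernel \<Lambda> \<mu>)"
  assumes density: "density_fun f0"
    and cont: "continuous_on UNIV f0"
    and B4: "0 < M" "\<And>x. 0 < f0 x \<and> f0 x \<le> M"
    and B5: "integrable lborel (\<lambda>x. f0 x * ln (f0 x))"
    and B6: "0 < \<delta>"
      "integrable lborel (\<lambda>x. f0 x * ln (f0 x / (INF t\<in>{t. norm (t - x) < \<delta>}. f0 t)))"
    and moment: "0 < \<eta>"
      "integrable lborel (\<lambda>x. norm x powr (2 * (1 + \<eta>)) * f0 x)"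
  shows "f0 \<in> KL_support Pstar"
proof -
  have pos: "0 < f0 x" for x using B4(2) by simp
  have "integrable lborel f0"
    using density less_imp_le[OF pos] by (intro integrableI_nonneg) (auto simp: density_fun_def)
  then have "integrable lborel (\<lambda>x. f0 x * (norm x)\<^sup>2)"
    using moment less_imp_le[OF pos] by (intro second_moment_of_higher_moment) auto
  then interpret KL_target f0
    using density cont pos B5 by unfold_locales
  have "0 < emeasure Pstar {f. KL f0 f < ereal \<epsilon>}" if "0 < \<epsilon>" for \<epsilon>
  proof -
    have e: "0 < \<epsilon> / 4" "ereal (4 * (\<epsilon> / 4)) = ereal \<epsilon>" "exp (- (\<epsilon> / 4)) < 1" using that by auto
    obtain r where r: "0 < r"
      "integrable lborel (\<lambda>x. f0 x * ln (f0 x / ball_inf f0 r x))"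
      "(\<integral>x. f0 x * ln (f0 x / ball_inf f0 r x) \<partial>lborel) < \<epsilon> / 4"
      using ball_inf_divergence_small[OF cont pos B6(1) _ e(1)] B6(2) by (auto simp: ball_inf_def)
    obtain \<phi>0 where \<phi>0: "0 < \<phi>0" "\<And>\<phi> (x :: real ^ 'n). 0 < \<phi> \<Longrightarrow> \<phi> < \<phi>0 \<Longrightarrow>
       ennreal (exp (- (\<epsilon> / 4))) \<le>
         (\<integral>\<^sup>+\<theta>. ennreal (loc_scale normal_kernel \<theta> \<phi> x) * indicator {\<theta>. norm (\<theta> - x) < r} \<theta> \<partial>lborel)"
      using loc_scale_concentrates[OF borel_measurable_normal_kernel nn_integral_normal_kernel r(1) e(3)] by blast
    from prior show ?thesis
    proof (elim disjE bexE conjE)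
      fix \<Lambda> :: "((real ^ 'n) \<times> real) measure measure"
      assume \<Lambda>: "\<Lambda> \<in> mixing_priors (UNIV \<times> {0<..})"
        "weak_support (UNIV \<times> {0<..}) \<Lambda> = prob_measures (UNIV \<times> {0<..})"
        "Pstar = type_I_prior normal_kernel \<Lambda>"
      have \<phi>: "0 < \<phi>0 / 2" "\<phi>0 / 2 < \<phi>0" using \<phi>0(1) by auto
      have h: "continuous_on UNIV (\<lambda>\<theta> :: real ^ 'n. (\<theta>, \<phi>0 / 2))"
        "range (\<lambda>\<theta> :: real ^ 'n. (\<theta>, \<phi>0 / 2)) \<subseteq> UNIV \<times> {0<..}"
        using \<phi>0(1) by (auto intro!: continuous_intros)
      obtain U where "openin (weak_topology (UNIV \<times> {0<..})) U" "U \<noteq> {}"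
        "\<And>P. P \<in> U \<Longrightarrow> KL f0 (\<lambda>x. \<integral>s. loc_scale normal_kernel (fst s) (snd s) x \<partial>P) < ereal (4 * (\<epsilon> / 4))"
        by (rule KL_small_on_weak_neighbourhood[OF log_quadratic_kernel_type_I h _ r \<phi>0(2)[OF \<phi>] e(1)]) auto
      then show ?thesis
        unfolding \<Lambda>(3) e(2)
        by (intro type_I_KL_positive[OF \<Lambda>(1,2) f0_measurable]) (auto simp: mixture_I_def[abs_def] split_beta')
    next
      fix \<Lambda> :: "(real ^ 'n) measure measure" and \<mu> :: "real measure"
      assume \<Lambda>: "\<Lambda> \<in> mixing_priors UNIV" "weak_support UNIV \<Lambda> = prob_measures UNIV"
        and \<mu>: "\<mu> \<in> prob_measures {0<..}" "\<forall>r>0. emeasure \<mu> {0<..<r} > 0"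
        and Pstar: "Pstar = type_II_prior normal_kernel \<Lambda> \<mu>"
      show ?thesis
        unfolding Pstar
      proof (rule type_II_KL_positive[OF \<Lambda> \<mu>(1) _ f0_measurable])
        show "emeasure \<mu> {0<..<\<phi>0} > 0" using \<mu>(2) \<phi>0(1) by simp
        fix \<phi> assume \<phi>: "0 < \<phi>" "\<phi> < \<phi>0"
        obtain U where "openin (weak_topology UNIV) U" "U \<noteq> {}"
          "\<And>P. P \<in> U \<Longrightarrow> KL f0 (\<lambda>x. \<integral>\<theta>. loc_scale normal_kernel \<theta> \<phi> x \<partial>P) < ereal (4 * (\<epsilon> / 4))"
          by (rule KL_small_on_weak_neighbourhood[OF log_quadratic_kernel_type_II[OF \<phi>(1)]
                continuous_on_id subset_UNIV _ r \<phi>0(2)[OF \<phi>] e(1)]) auto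
        then show "\<exists>U. openin (weak_topology UNIV) U \<and> U \<noteq> {} \<and>
            (\<forall>P\<in>U. KL f0 (mixture_II normal_kernel P \<phi>) < ereal \<epsilon>)"
          unfolding e(2) by (intro exI[of _ U]) (auto simp: mixture_II_def[abs_def])
      qed
    qed
  qed
  then show ?thesis by (auto simp: KL_support_def)
qed

end
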